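(* Consider the closed-loop system described in the context with a physically realizable controller given by the Hamiltonian parameterization $a=J_0R+bJb^{T}J_0/2$, $c=J_2\mathbf{I}^{T}b^{T}J_0$, where $R\in\mathbb{S}_n$ and $b\in\mathbb{R}^{n\times(m_2+p)}$, and suppose $\mathcal{A}$ is Hurwitz. Regard $E$ as a function of $(R,b)\in\mathbb{S}_n\times\mathbb{R}^{n\times(m_2+p)}$. Then $(R,b)$ is a critical point of $E$ (i.e. the Fréchet derivatives of $E$ with respect to $R$ and to $b$ both vanish) if and only if there exists a real antisymmetric matrix $\Phi$ of order $n$ such that $$H_{22}=-\Phi J_0$$ and $$\mathfrak{M}(b)+H_{21}\mathbf{C}^{T}+Q_{21}B\mathbf{D}^{T}+J_0\big(H_{12}^{T}B_2+P_{21}C_0^{T}D_0\big)J_2\mathbf{I}^{T}=0,$$ where $\mathfrak{M}$ is the linear operator on $\mathbb{R}^{n\times(m_2+p)}$ given by $$\mathfrak{M}(X):=\Phi XJ+Q_{22}X\mathbf{D}\mathbf{D}^{T}+J_0P_{22}J_0X\mathbf{I}J_2D_0^{T}D_0J_2\mathbf{I}^{T}.$$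
   Context: Let $n=2\nu$, $m_1=2\mu_1$, $m_2=2\mu_2$, and let $p,p_0$ be positive integers. Plant matrices: $A\in\mathbb{R}^{n\times n}$, $B_1\in\mathbb{R}^{n\times m_1}$, $B_2\in\mathbb{R}^{n\times m_2}$, $C\in\mathbb{R}^{p\times n}$, $D\in\mathbb{R}^{p\times m_1}$, $C_0\in\mathbb{R}^{p_0\times n}$, $D_0\in\mathbb{R}^{p_0\times m_2}$. $J_0,J_1,J_2$ are the canonical real antisymmetric matrices of orders $n,m_1,m_2$ (block diagonal with copies of $\begin{bmatrix}0&1\\-1&0\end{bmatrix}$). $J:=\begin{bmatrix}J_2&0\\0&DJ_1D^{T}\end{bmatrix}$, $\mathbf{I}:=\begin{bmatrix}I_{m_2}\\0\end{bmatrix}\in\mathbb{R}^{(m_2+p)\times m_2}$, and $\mathbb{S}_n$ denotes real symmetric $n\times n$ matrices. Controller matrices $a\in\mathbb{R}^{n\times n}$, $b=[\,b_1\ \ b_2\,]\in\mathbb{R}^{n\times(m_2+p)}$ with $b_1\in\mathbb{R}^{n\times m_2}$, $b_2\in\mathbb{R}^{n\times p}$, and $c\in\mathbb{R}^{m_2\times n}$. Set $B:=[\,B_1\ \ B_2\,]$, $\mathbf{C}:=\begin{bmatrix}0\\ C\end{bmatrix}\in\mathbb{R}^{(m_2+p)\times n}$, $\mathbf{D}:=\begin{bmatrix}0 & I_{m_2}\\ D & 0\end{bmatrix}$. Closed-loop matrices: $\mathcal{A}:=\begin{bmatrix}A & B_2c\\ b\mathbf{C} & a\end{bmatrix}$,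 $\mathcal{B}:=\begin{bmatrix}B\\ b\mathbf{D}\end{bmatrix}$, $\mathcal{C}:=\begin{bmatrix}C_0 & D_0c\end{bmatrix}$. When $\mathcal{A}$ is Hurwitz, $P,Q$ are the unique solutions of $\mathcal{A}P+P\mathcal{A}^{T}+\mathcal{B}\mathcal{B}^{T}=0$, $\mathcal{A}^{T}Q+Q\mathcal{A}+\mathcal{C}^{T}\mathcal{C}=0$; $E:=\mathrm{Tr}(\mathcal{C}P\mathcal{C}^{T})$; $H:=QP$. $H,P,Q$ are partitioned into $n\times n$ blocks $H_{jk},P_{jk},Q_{jk}$, $j,k\in\{1,2\}$. Derivatives are Fréchet derivatives with respect to the Frobenius inner product (for $R$, on the space $\mathbb{S}_n$). *)

theory Defs
  imports Complex_Main "Jordan_Normal_Form.Char_Poly"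
begin

text \<open>Canonical real antisymmetric matrix of order k: block diagonal with copies of
  [[0,1],[-1,0]] (k is assumed even where used).\<close>
definition canonJ :: "nat \<Rightarrow> real mat" where
  "canonJ k = mat k k (\<lambda>(i,j). if even i \<and> j = i + 1 then 1
                               else if odd i \<and> i = j + 1 then -1 else 0)"

definition hcat :: "real mat \<Rightarrow> real mat \<Rightarrow> real mat" where
  "hcat X Y = mat (dim_row X) (dim_col X + dim_col Y)
     (\<lambda>(i,j). if j < dim_col X then X $$ (i,j) else Y $$ (i, j - dim_col X))"

definition vcat :: "real mat \<Rightarrow> real mat \<Rightarrow> real mat" where
  "vcat X Y = mat (dim_row X + dim_row Y) (dim_col X)
     (\<lambda>(i,j). if i < dim_row X then X $$ (i,j) else Y $$ (i - dim_row X, j))"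

definition blockdiag :: "real mat \<Rightarrow> real mat \<Rightarrow> real mat" where
  "blockdiag X Y = vcat (hcat X (0\<^sub>m (dim_row X) (dim_col Y)))
                        (hcat (0\<^sub>m (dim_row Y) (dim_col X)) Y)"

text \<open>The (j,k) block (j,k \<in> {1,2}) of size k0 x k0 of a 2k0 x 2k0 matrix.\<close>
definition blk :: "real mat \<Rightarrow> nat \<Rightarrow> nat \<Rightarrow> nat \<Rightarrow> real mat" where
  "blk X k0 j k = mat k0 k0 (\<lambda>(r,s). X $$ ((j - 1) * k0 + r, (k - 1) * k0 + s))"

definition mtrace :: "real mat \<Rightarrow> real" where
  "mtrace X = (\<Sum>i<dim_row X. X $$ (i,i))"

definition frob :: "real mat \<Rightarrow> real" where
  "frob X = sqrt (\<Sum>i<dim_row X. \<Sum>j<dim_col X. (X $$ (i,j))\<^sup>2)"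

definition hurwitz :: "real mat \<Rightarrow> bool" where
  "hurwitz M \<longleftrightarrow> M \<in> carrier_mat (dim_row M) (dim_row M) \<and>
     (\<forall>k. eigenvalue (map_mat complex_of_real M) k \<longrightarrow> Re k < 0)"

record plant =
  pA :: "real mat"
  pB1 :: "real mat"
  pB2 :: "real mat"
  pC :: "real mat"
  pD :: "real mat"
  pC0 :: "real mat"
  pD0 :: "real mat"

text \<open>Dimensions: n = dim_row A, m1 = dim_col B1, m2 = dim_col B2, p = dim_row C.\<close>

definition J0 :: "plant \<Rightarrow> real mat" where "J0 G = canonJ (dim_row (pA G))"
definition J1 :: "plant \<Rightarrow> real mat" where "J1 G = canonJ (dim_col (pB1 G))"
definition J2 :: "plant \<Rightarrow> real mat" where "J2 G = canonJ (dim_col (pB2 G))"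

definition bigJ :: "plant \<Rightarrow> real mat" where
  "bigJ G = blockdiag (J2 G) (pD G * J1 G * transpose_mat (pD G))"

definition bfI :: "plant \<Rightarrow> real mat" where
  "bfI G = vcat (1\<^sub>m (dim_col (pB2 G))) (0\<^sub>m (dim_row (pC G)) (dim_col (pB2 G)))"

definition bfC :: "plant \<Rightarrow> real mat" where
  "bfC G = vcat (0\<^sub>m (dim_col (pB2 G)) (dim_row (pA G))) (pC G)"

definition bfD :: "plant \<Rightarrow> real mat" where
  "bfD G = vcat (hcat (0\<^sub>m (dim_col (pB2 G)) (dim_col (pB1 G))) (1\<^sub>m (dim_col (pB2 G))))
                (hcat (pD G) (0\<^sub>m (dim_row (pC G)) (dim_col (pB2 G))))"

definition Bcat :: "plant \<Rightarrow> real mat" where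
  "Bcat G = hcat (pB1 G) (pB2 G)"

definition ctrl_a :: "plant \<Rightarrow> real mat \<Rightarrow> real mat \<Rightarrow> real mat" where
  "ctrl_a G R b = J0 G * R + (1/2) \<cdot>\<^sub>m (b * bigJ G * transpose_mat b * J0 G)"

definition ctrl_c :: "plant \<Rightarrow> real mat \<Rightarrow> real mat" where
  "ctrl_c G b = J2 G * transpose_mat (bfI G) * transpose_mat b * J0 G"

definition clA :: "plant \<Rightarrow> real mat \<Rightarrow> real mat \<Rightarrow> real mat" where
  "clA G R b = vcat (hcat (pA G) (pB2 G * ctrl_c G b)) (hcat (b * bfC G) (ctrl_a G R b))"

definition clB :: "plant \<Rightarrow> real mat \<Rightarrow> real mat" where
  "clB G b = vcat (Bcat G) (b * bfD G)"

definition clC :: "plant \<Rightarrow> real mat \<Rightarrow> real mat" where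
  "clC G b = hcat (pC0 G) (pD0 G * ctrl_c G b)"

text \<open>Controllability / observability Gramians (unique solutions when clA is Hurwitz).\<close>
definition gramP :: "plant \<Rightarrow> real mat \<Rightarrow> real mat \<Rightarrow> real mat" where
  "gramP G R b = (THE P. P \<in> carrier_mat (2 * dim_row (pA G)) (2 * dim_row (pA G)) \<and>
      clA G R b * P + P * transpose_mat (clA G R b) + clB G b * transpose_mat (clB G b)
        = 0\<^sub>m (2 * dim_row (pA G)) (2 * dim_row (pA G)))"

definition gramQ :: "plant \<Rightarrow> real mat \<Rightarrow> real mat \<Rightarrow> real mat" where
  "gramQ G R b = (THE Q. Q \<in> carrier_mat (2 * dim_row (pA G)) (2 * dim_row (pA G)) \<and>
      transpose_mat (clA G R b) * Q + Q * clA G R b + transpose_mat (clC G b) * clC G b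
        = 0\<^sub>m (2 * dim_row (pA G)) (2 * dim_row (pA G)))"

definition costE :: "plant \<Rightarrow> real mat \<Rightarrow> real mat \<Rightarrow> real" where
  "costE G R b = mtrace (clC G b * gramP G R b * transpose_mat (clC G b))"

text \<open>Vanishing Fr\'echet derivative of E w.r.t. R (on the space of symmetric matrices,
  Frobenius norm) and w.r.t. b (on R^{n x (m2+p)}), written out via the definition.\<close>
definition dE_R_zero :: "plant \<Rightarrow> real mat \<Rightarrow> real mat \<Rightarrow> bool" where
  "dE_R_zero G R b \<longleftrightarrow> (\<forall>\<epsilon>>0. \<exists>\<delta>>0. \<forall>dR.
     dR \<in> carrier_mat (dim_row (pA G)) (dim_row (pA G)) \<and> transpose_mat dR = dR \<and> frob dR < \<delta>
     \<longrightarrow> \<bar>costE G (R + dR) b - costE G R b\<bar> \<le> \<epsilon> * frob dR)"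

definition dE_b_zero :: "plant \<Rightarrow> real mat \<Rightarrow> real mat \<Rightarrow> bool" where
  "dE_b_zero G R b \<longleftrightarrow> (\<forall>\<epsilon>>0. \<exists>\<delta>>0. \<forall>db.
     db \<in> carrier_mat (dim_row (pA G)) (dim_col (pB2 G) + dim_row (pC G)) \<and> frob db < \<delta>
     \<longrightarrow> \<bar>costE G R (b + db) - costE G R b\<bar> \<le> \<epsilon> * frob db)"

definition opM :: "plant \<Rightarrow> real mat \<Rightarrow> real mat \<Rightarrow> real mat \<Rightarrow> real mat \<Rightarrow> real mat" where
  "opM G R b \<Phi> X = (let n = dim_row (pA G); Q = gramQ G R b; P = gramP G R b in
     \<Phi> * X * bigJ G + blk Q n 2 2 * X * bfD G * transpose_mat (bfD G)
     + J0 G * blk P n 2 2 * J0 G * X * bfI G * J2 G * transpose_mat (pD0 G) * pD0 G * J2 G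
         * transpose_mat (bfI G))"

end

theory Submission
  imports Defs "Jordan_Normal_Form.Schur_Decomposition"
begin

text \<open>
  The cost is the pairing \<open>\<langle>C\<^sup>T C, P\<rangle>\<close> with the solution of a Lyapunov equation. Pairing
  the perturbed equation for \<open>P\<close> with the unperturbed adjoint solution \<open>Q\<close> gives
  \<open>dE = 2 (\<langle>QP, dA\<rangle> + \<langle>QB, dB\<rangle> + \<langle>CP, dC\<rangle>)\<close> with a quadratic remainder. In the direction of
  \<open>R\<close> this is the pairing with \<open>J\<^sub>0\<^sup>T H\<^sub>2\<^sub>2\<close>, which vanishes on symmetric matrices iff that matrix,
  equivalently its congruent \<open>\<Phi> = H\<^sub>2\<^sub>2 J\<^sub>0\<close>, is antisymmetric. In the direction of \<open>b\<close> the term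
  of \<open>a\<close> quadratic in \<open>b\<close> contributes \<open>(H\<^sub>2\<^sub>2 J\<^sub>0 + J\<^sub>0 H\<^sub>2\<^sub>2\<^sup>T) b J / 2\<close>, which is \<open>\<Phi> b J\<close> once
  \<open>\<Phi>\<close> is antisymmetric.
\<close>

subsection \<open>Frobenius inner product and entrywise norm\<close>

text \<open>The obstacle is that \<open>costE\<close> goes through a definite description: at a
  perturbed pair its value is accessible only once the perturbed Lyapunov equation is known to have
  exactly one solution. Stability of the perturbed matrix is never examined. The spectrum is used at
  the base point alone, to make X |-> A X + X A^T injective; in finite dimension this yields a bound
  \<open>nrm X \<le> \<kappa> * nrm (A * X + X * A\<^sup>T)\<close>, and such a bound survives small
  changes of \<open>A\<close>. It gives solvability nearby and a change of \<open>P\<close> of the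
  same order as the perturbation, which is all that the quadratic remainder requires. The two
  equations of the theorem match the two derivatives only jointly. Vanishing in b alone gives the
  second equation with the symmetrised matrix (H22 J0 + J0 H22^T)/2 in place of Phi; vanishing in R
  is what turns that matrix into H22 J0.\<close>

lemma index_mult_sum:
  "i < dim_row A \<Longrightarrow> j < dim_col B \<Longrightarrow> dim_col A = dim_row B \<Longrightarrow>
   (A * B) $$ (i,j) = (\<Sum>k<dim_row B. A $$ (i,k) * B $$ (k,j))"
  by (simp add: scalar_prod_def atLeast0LessThan)

text \<open>Here and in the following rules the side conditions are equations between dimensions.
  Carrier premises would mention sizes that do not occur in the conclusion and that simp would have
  to guess.\<close>

lemma mult_assoc_dim:
  "dim_col A = dim_row B \<Longrightarrow> dim_col B = dim_row C \<Longrightarrow> A * B * C = A * (B * C)"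
  for A B C :: "'a::semiring_0 mat"
  by (rule assoc_mult_mat[of _ "dim_row A" "dim_row B" _ "dim_row C" _ "dim_col C"]) auto

lemma add_mult_dim:
  "dim_row A = dim_row B \<Longrightarrow> dim_col A = dim_col B \<Longrightarrow> dim_col B = dim_row C \<Longrightarrow>
   (A + B) * C = A * C + B * C" for A B C :: "'a::semiring_0 mat"
  by (rule add_mult_distrib_mat[of _ "dim_row A" "dim_row C" _ _ "dim_col C"]) auto

lemma mult_add_dim:
  "dim_row B = dim_row C \<Longrightarrow> dim_col B = dim_col C \<Longrightarrow> dim_col A = dim_row C \<Longrightarrow>
   A * (B + C) = A * B + A * C" for A B C :: "'a::semiring_0 mat"
  by (rule mult_add_distrib_mat[of _ "dim_row A" "dim_row C" _ "dim_col C"]) auto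

lemma transpose_mult_dim:
  "dim_col A = dim_row B \<Longrightarrow> (A * B)\<^sup>T = B\<^sup>T * A\<^sup>T" for A B :: "'a::comm_semiring_0 mat"
  by (rule transpose_mult[of _ "dim_row A" "dim_row B" _ "dim_col B"]) auto

lemma transpose_add_dim:
  "dim_row A = dim_row B \<Longrightarrow> dim_col A = dim_col B \<Longrightarrow> (A + B)\<^sup>T = A\<^sup>T + B\<^sup>T"
  by (rule eq_matI) auto

lemma transpose_smult: "(c \<cdot>\<^sub>m A)\<^sup>T = c \<cdot>\<^sub>m A\<^sup>T"
  by (rule eq_matI) auto

lemma smult_mult_dim: "dim_col A = dim_row B \<Longrightarrow> (c \<cdot>\<^sub>m A) * B = c \<cdot>\<^sub>m (A * B)"
  for A B :: "real mat"
  by (rule eq_matI) (auto simp: index_mult_sum sum_distrib_left algebra_simps simp del: index_mult_mat(1))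

lemma add_zero_dim: "dim_row A = r \<Longrightarrow> dim_col A = c \<Longrightarrow> A + 0\<^sub>m r c = A" for A :: "real mat"
  by (rule eq_matI) auto

definition ip :: "real mat \<Rightarrow> real mat \<Rightarrow> real" where
  "ip X Y = (\<Sum>i<dim_row X. \<Sum>j<dim_col X. X $$ (i,j) * Y $$ (i,j))"

text \<open>The entrywise 1-norm is submultiplicative, additive over blocks and free of square
  roots. The Frobenius norm of the definitions is reached only at the end, by equivalence of the two
  norms in fixed dimension.\<close>

definition nrm :: "real mat \<Rightarrow> real" where
  "nrm X = (\<Sum>i<dim_row X. \<Sum>j<dim_col X. \<bar>X $$ (i,j)\<bar>)"

lemma ip_add_left: "dim_row X = dim_row Y \<Longrightarrow> dim_col X = dim_col Y \<Longrightarrow> ip (X + Y) Z = ip X Z + ip Y Z"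
  by (simp add: ip_def algebra_simps sum.distrib)

lemma ip_add_right:
  "dim_row X = dim_row Y \<Longrightarrow> dim_col X = dim_col Y \<Longrightarrow> dim_row Z = dim_row Y \<Longrightarrow> dim_col Z = dim_col Y \<Longrightarrow>
   ip Z (X + Y) = ip Z X + ip Z Y"
  by (simp add: ip_def algebra_simps sum.distrib)

lemma ip_uminus_left: "ip (- X) Z = - ip X Z"
  by (simp add: ip_def sum_negf)

lemma ip_smult_left: "ip (c \<cdot>\<^sub>m X) Z = c * ip X Z"
  by (simp add: ip_def sum_distrib_left algebra_simps)

lemma ip_smult_right: "dim_row Z = dim_row X \<Longrightarrow> dim_col Z = dim_col X \<Longrightarrow> ip Z (c \<cdot>\<^sub>m X) = c * ip Z X"
  by (simp add: ip_def sum_distrib_left algebra_simps)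

lemma ip_zero_right: "ip X (0\<^sub>m (dim_row X) (dim_col X)) = 0"
  by (simp add: ip_def)

lemma ip_commute: "dim_row X = dim_row Y \<Longrightarrow> dim_col X = dim_col Y \<Longrightarrow> ip X Y = ip Y X"
  by (simp add: ip_def mult.commute)

lemma ip_transpose: "dim_row X = dim_row Y \<Longrightarrow> dim_col X = dim_col Y \<Longrightarrow> ip X\<^sup>T Y\<^sup>T = ip X Y"
  by (simp add: ip_def) (rule sum.swap)

text \<open>After expansion both sides are the same triple sum; only the order of summation differs.
  Together with its mirror image this is how every gradient below is read off.\<close>

lemma ip_mult_right:
  assumes "dim_row X = dim_row A" "dim_col X = dim_col B" "dim_col A = dim_row B"
  shows "ip X (A * B) = ip (A\<^sup>T * X) B"
proof -
  have "ip X (A * B) = (\<Sum>i<dim_row A. \<Sum>j<dim_col B. \<Sum>k<dim_row B. X $$ (i,j) * (A $$ (i,k) * B $$ (k,j)))"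
    using assms by (simp add: ip_def index_mult_sum sum_distrib_left del: index_mult_mat(1))
  also have "\<dots> = (\<Sum>i<dim_row A. \<Sum>k<dim_row B. \<Sum>j<dim_col B. X $$ (i,j) * (A $$ (i,k) * B $$ (k,j)))"
    by (intro sum.cong refl sum.swap)
  also have "\<dots> = (\<Sum>k<dim_row B. \<Sum>i<dim_row A. \<Sum>j<dim_col B. X $$ (i,j) * (A $$ (i,k) * B $$ (k,j)))"
    by (rule sum.swap)
  also have "\<dots> = (\<Sum>k<dim_row B. \<Sum>j<dim_col B. \<Sum>i<dim_row A. X $$ (i,j) * (A $$ (i,k) * B $$ (k,j)))"
    by (intro sum.cong refl sum.swap)
  also have "\<dots> = ip (A\<^sup>T * X) B"
    using assms by (simp add: ip_def index_mult_sum sum_distrib_left sum_distrib_right algebra_simps del: index_mult_mat(1))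
  finally show ?thesis .
qed

lemma ip_mult_right':
  assumes "dim_row X = dim_row A" "dim_col X = dim_col B" "dim_col A = dim_row B"
  shows "ip X (A * B) = ip (X * B\<^sup>T) A"
proof -
  have "ip X (A * B) = ip X\<^sup>T (B\<^sup>T * A\<^sup>T)"
    using assms by (subst ip_transpose[symmetric]) (simp_all add: transpose_mult_dim)
  also have "\<dots> = ip (B * X\<^sup>T) A\<^sup>T"
    using assms by (subst ip_mult_right) simp_all
  also have "\<dots> = ip (X * B\<^sup>T) A"
    using assms by (subst ip_transpose[symmetric]) (simp_all add: transpose_mult_dim)
  finally show ?thesis .
qed

text \<open>The trace is the pairing with the identity, and the outer factors move across by
  adjointness. The cost becomes a linear functional of \<open>P\<close>, the form that duality
  needs.\<close>

lemma mtrace_congruence: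
  assumes "dim_col C = dim_row P" "dim_col P = dim_col C"
  shows "mtrace (C * P * C\<^sup>T) = ip (C\<^sup>T * C) P"
proof -
  have "mtrace (C * P * C\<^sup>T) = ip (1\<^sub>m (dim_row C)) (C * P * C\<^sup>T)"
    using assms by (simp add: mtrace_def ip_def if_distrib[of "\<lambda>x. x * _"] sum.delta cong: if_cong del: index_mult_mat(1))
  also have "\<dots> = ip (C\<^sup>T * C) P"
  proof -
    have "ip (1\<^sub>m (dim_row C)) (C * P * C\<^sup>T) = ip C (C * P)"
      using assms by (subst ip_mult_right') simp_all
    also have "\<dots> = ip (C\<^sup>T * C) P"
      using assms by (subst ip_mult_right) simp_all
    finally show ?thesis .
  qed
  finally show ?thesis .
qed

section \<open>Estimates for the entrywise norm and comparison with the Frobenius norm\<close>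

lemma nrm_nonneg: "0 \<le> nrm X"
  by (simp add: nrm_def sum_nonneg)

lemma entry_le_nrm: "i < dim_row X \<Longrightarrow> j < dim_col X \<Longrightarrow> \<bar>X $$ (i,j)\<bar> \<le> nrm X"
  unfolding nrm_def
  by (rule order_trans[OF member_le_sum[of j "{..<dim_col X}" "\<lambda>j. \<bar>X $$ (i,j)\<bar>"]
      member_le_sum[of i "{..<dim_row X}" "\<lambda>i. \<Sum>j<dim_col X. \<bar>X $$ (i,j)\<bar>"]])
     (auto simp: sum_nonneg)

lemma nrm_eq_0D: "nrm X = 0 \<Longrightarrow> X = 0\<^sub>m (dim_row X) (dim_col X)"
  by (intro eq_matI) (use entry_le_nrm[of _ X] in fastforce)+

lemma nrm_zero: "nrm (0\<^sub>m r c) = 0"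
  by (simp add: nrm_def)

lemma nrm_add:
  assumes "dim_row X = dim_row Y" "dim_col X = dim_col Y"
  shows "nrm (X + Y) \<le> nrm X + nrm Y"
proof -
  have "nrm (X + Y) \<le> (\<Sum>i<dim_row Y. \<Sum>j<dim_col Y. \<bar>X $$ (i,j)\<bar> + \<bar>Y $$ (i,j)\<bar>)"
    unfolding nrm_def index_add_mat(2,3) by (intro sum_mono) auto
  also have "\<dots> = nrm X + nrm Y"
    using assms by (simp add: nrm_def sum.distrib)
  finally show ?thesis .
qed

lemma nrm_uminus: "nrm (- X) = nrm X"
  by (simp add: nrm_def)

lemma nrm_smult: "nrm (c \<cdot>\<^sub>m X) = \<bar>c\<bar> * nrm X"
  by (simp add: nrm_def abs_mult sum_distrib_left)

lemma nrm_transpose: "nrm X\<^sup>T = nrm X"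
  by (simp add: nrm_def) (rule sum.swap)

lemma nrm_mult:
  assumes "dim_col X = dim_row Y"
  shows "nrm (X * Y) \<le> nrm X * nrm Y"
proof -
  let ?x = "\<lambda>k. \<Sum>i<dim_row X. \<bar>X $$ (i,k)\<bar>" and ?y = "\<lambda>k. \<Sum>j<dim_col Y. \<bar>Y $$ (k,j)\<bar>"
  have "nrm (X * Y) \<le> (\<Sum>i<dim_row X. \<Sum>j<dim_col Y. \<Sum>k<dim_row Y. \<bar>X $$ (i,k)\<bar> * \<bar>Y $$ (k,j)\<bar>)"
    using assms unfolding nrm_def
    by (auto simp: index_mult_sum abs_mult[symmetric] simp del: index_mult_mat(1) intro!: sum_mono sum_abs)
  also have "\<dots> = (\<Sum>i<dim_row X. \<Sum>k<dim_row Y. \<Sum>j<dim_col Y. \<bar>X $$ (i,k)\<bar> * \<bar>Y $$ (k,j)\<bar>)"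
    by (intro sum.cong refl sum.swap)
  also have "\<dots> = (\<Sum>k<dim_row Y. \<Sum>i<dim_row X. \<Sum>j<dim_col Y. \<bar>X $$ (i,k)\<bar> * \<bar>Y $$ (k,j)\<bar>)"
    by (rule sum.swap)
  also have "\<dots> = (\<Sum>k<dim_row Y. ?x k * ?y k)"
    by (simp add: sum_product)
  \<comment> \<open>Each absolute row sum of \<open>Y\<close> is at most \<open>nrm Y\<close>; what
    remains is \<open>nrm X\<close> summed column by column.\<close>
  also have "\<dots> \<le> (\<Sum>k<dim_row Y. ?x k * nrm Y)"
    unfolding nrm_def
    by (intro sum_mono mult_left_mono sum_nonneg member_le_sum[of _ "{..<dim_row Y}" ?y]) auto
  also have "\<dots> = nrm X * nrm Y"
    using assms unfolding nrm_def sum_distrib_right[symmetric] by (subst sum.swap) simp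
  finally show ?thesis .
qed

lemma ip_le_nrm:
  assumes "dim_row X = dim_row Y" "dim_col X = dim_col Y"
  shows "\<bar>ip X Y\<bar> \<le> nrm X * nrm Y"
proof -
  have "\<bar>ip X Y\<bar> \<le> (\<Sum>i<dim_row X. \<Sum>j<dim_col X. \<bar>X $$ (i,j)\<bar> * \<bar>Y $$ (i,j)\<bar>)"
    unfolding ip_def by (auto simp: abs_mult[symmetric] intro!: order_trans[OF sum_abs] sum_mono)
  also have "\<dots> \<le> (\<Sum>i<dim_row X. \<Sum>j<dim_col X. \<bar>X $$ (i,j)\<bar> * nrm Y)"
    using assms by (intro sum_mono mult_left_mono entry_le_nrm) auto
  also have "\<dots> = nrm X * nrm Y"
    by (simp add: nrm_def sum_distrib_right)
  finally show ?thesis .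
qed

lemma frob_le_nrm: "frob X \<le> nrm X"
proof -
  have "(\<Sum>i<dim_row X. \<Sum>j<dim_col X. (X $$ (i,j))\<^sup>2) \<le> (\<Sum>i<dim_row X. \<Sum>j<dim_col X. \<bar>X $$ (i,j)\<bar> * nrm X)"
  proof (intro sum_mono)
    fix i j assume "i \<in> {..<dim_row X}" "j \<in> {..<dim_col X}"
    then have "\<bar>X $$ (i,j)\<bar> * \<bar>X $$ (i,j)\<bar> \<le> \<bar>X $$ (i,j)\<bar> * nrm X"
      by (intro mult_left_mono entry_le_nrm) auto
    then show "(X $$ (i,j))\<^sup>2 \<le> \<bar>X $$ (i,j)\<bar> * nrm X"
      by (simp add: power2_eq_square)
  qed
  also have "\<dots> = (nrm X)\<^sup>2"
    by (simp add: nrm_def sum_distrib_right power2_eq_square)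
  finally show ?thesis
    unfolding frob_def by (intro real_le_lsqrt nrm_nonneg) (simp add: sum_nonneg)
qed

lemma frob_nonneg: "0 \<le> frob X"
  by (simp add: frob_def sum_nonneg)

lemma entry_le_frob:
  assumes "i < dim_row X" "j < dim_col X"
  shows "\<bar>X $$ (i,j)\<bar> \<le> frob X"
proof -
  have "(X $$ (i,j))\<^sup>2 \<le> (\<Sum>j<dim_col X. (X $$ (i,j))\<^sup>2)"
    using assms by (intro member_le_sum[of j "{..<dim_col X}" "\<lambda>j. (X $$ (i,j))\<^sup>2"]) auto
  also have "\<dots> \<le> (\<Sum>i<dim_row X. \<Sum>j<dim_col X. (X $$ (i,j))\<^sup>2)"
    using assms by (intro member_le_sum[of i "{..<dim_row X}" "\<lambda>i. \<Sum>j<dim_col X. (X $$ (i,j))\<^sup>2"]) (auto simp: sum_nonneg)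
  finally show ?thesis
    unfolding frob_def by (intro real_le_rsqrt) simp
qed

text \<open>Every entry is bounded by the Frobenius norm, so the number of entries serves as the
  constant. Any constant depending on the dimensions alone would do.\<close>

lemma nrm_le_frob: "nrm X \<le> real (dim_row X * dim_col X) * frob X"
proof -
  have "nrm X \<le> (\<Sum>i<dim_row X. \<Sum>j<dim_col X. frob X)"
    unfolding nrm_def by (intro sum_mono entry_le_frob) auto
  then show ?thesis by (simp add: algebra_simps)
qed

lemma frob_smult: "frob (c \<cdot>\<^sub>m X) = \<bar>c\<bar> * frob X"
  by (simp add: frob_def power_mult_distrib sum_distrib_left[symmetric] real_sqrt_mult)

subsection \<open>Sylvester and Lyapunov equations\<close>

text \<open>Triangularising \<open>M\<close> makes the columns of \<open>X\<close> vanish one after the other: the first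
  nonzero one would be an eigenvector of \<open>A\<close> for a diagonal entry of the triangular form.\<close>

lemma sylvester_zero:
  fixes A M X :: "complex mat"
  assumes A: "A \<in> carrier_mat n n" and M: "M \<in> carrier_mat m m" and X: "X \<in> carrier_mat n m"
    and eq: "A * X = X * M" and disj: "\<And>k. eigenvalue A k \<Longrightarrow> eigenvalue M k \<Longrightarrow> False"
  shows "X = 0\<^sub>m n m"
proof -
  obtain es where "char_poly M = (\<Prod>a\<leftarrow>es. [:- a, 1:])"
    using char_poly_factorized[OF M] by auto
  from schur_decomposition_exists[OF M this] obtain T where
    T: "T \<in> carrier_mat m m" "upper_triangular T" "similar_mat M T" by auto
  then obtain S S' where wit: "similar_mat_wit M T S S'"
    unfolding similar_mat_def by auto
  note w = similar_mat_witD2[OF M wit]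
  have S: "S \<in> carrier_mat m m" "S' \<in> carrier_mat m m" "M = S * T * S'" "S' * S = 1\<^sub>m m" "S * S' = 1\<^sub>m m"
    using w by auto
  define Y where "Y = X * S"
  have Y: "Y \<in> carrier_mat n m" using X S by (auto simp: Y_def)
  have "A * Y = X * M * S"
    using A X S(1) by (simp add: Y_def mult_assoc_dim[symmetric] eq del: assoc_mult_mat)
  also have "\<dots> = Y * T"
    using X S T(1) by (simp add: Y_def mult_assoc_dim S(3))
  finally have YT: "A * Y = Y * T" .
  \<comment> \<open>The diagonal entries of the triangular \<open>T\<close> are the roots of its
    characteristic polynomial, which similarity shares with \<open>M\<close>.\<close>
  have ev: "eigenvalue M (T $$ (j,j))" if "j < m" for j
  proof -
    have "poly (char_poly T) (T $$ (j,j)) = 0"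
      using that T by (subst char_poly_upper_triangular[OF T(1,2)])
        (auto simp: poly_prod_list prod_list_zero_iff diag_mat_def)
    then show ?thesis
      using eigenvalue_root_char_poly[OF M] char_poly_similar[OF T(3)] by simp
  qed
  have Y0: "\<forall>i<n. Y $$ (i,j) = 0" if "j < m" for j
    using that
  proof (induction j rule: less_induct)
    case (less j)
    have "A *\<^sub>v col Y j = T $$ (j,j) \<cdot>\<^sub>v col Y j"
    proof (rule eq_vecI)
      fix i assume i: "i < dim_vec (T $$ (j, j) \<cdot>\<^sub>v col Y j)"
      then have i: "i < n" using Y by simp
      have "(A *\<^sub>v col Y j) $ i = (A * Y) $$ (i,j)"
        using i less.prems A Y by simp
      also have "\<dots> = (\<Sum>k<m. Y $$ (i,k) * T $$ (k,j))"
        using i less.prems T Y unfolding YT by (subst index_mult_sum) auto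
      \<comment> \<open>For k < j column k of \<open>Y\<close> vanishes by induction; for k > j the
        entry of the upper triangular \<open>T\<close> is zero.\<close>
      also have "\<dots> = (\<Sum>k<m. if k = j then Y $$ (i,k) * T $$ (k,j) else 0)"
      proof (rule sum.cong[OF refl])
        fix k assume "k \<in> {..<m}"
        then show "Y $$ (i,k) * T $$ (k,j) = (if k = j then Y $$ (i,k) * T $$ (k,j) else 0)"
          using less i T(1) upper_triangularD[OF T(2), of j k] by (cases k j rule: linorder_cases) auto
      qed
      also have "\<dots> = (T $$ (j,j) \<cdot>\<^sub>v col Y j) $ i"
        using less.prems i Y by (simp add: sum.delta mult.commute)
      finally show "(A *\<^sub>v col Y j) $ i = (T $$ (j,j) \<cdot>\<^sub>v col Y j) $ i" .
    qed (use A Y in auto)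
    moreover have "col Y j \<in> carrier_vec n"
      using Y less.prems by simp
    ultimately have "col Y j = 0\<^sub>v n"
      using disj[OF _ ev[OF less.prems]] A unfolding eigenvalue_def eigenvector_def by auto
    then show ?case
      using Y less.prems by (metis carrier_matD(1) carrier_matD(2) index_col index_zero_vec(1))
  qed
  have "X = Y * S'"
    using X S by (simp add: Y_def mult_assoc_dim)
  also have "Y = 0\<^sub>m n m"
    using Y Y0 by (intro eq_matI) auto
  finally show ?thesis using S by simp
qed

lemma eigenvalue_transpose:
  "A \<in> carrier_mat n n \<Longrightarrow> eigenvalue A\<^sup>T k = eigenvalue A k" for A :: "'a::field mat"
  by (simp add: eigenvalue_root_char_poly[of _ n])

text \<open>The equation for \<open>Q\<close> is a Lyapunov equation for the transposed matrix, so
  all results apply to it through this lemma.\<close>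

lemma hurwitz_transpose:
  assumes "hurwitz A"
  shows "hurwitz A\<^sup>T"
proof -
  have "map_mat complex_of_real A \<in> carrier_mat (dim_row A) (dim_row A)" "dim_col A = dim_row A"
    using assms by (auto simp: hurwitz_def)
  then show ?thesis
    using assms eigenvalue_transpose[of "map_mat complex_of_real A", unfolded map_mat_transpose]
    unfolding hurwitz_def by auto
qed

text \<open>The equation reads A X = X (-A^T). The eigenvalues of -A^T are the negatives of those of
  A and lie in the open right half plane, so the two spectra are disjoint and
  \<open>sylvester_zero\<close> applies over the complex numbers.\<close>

lemma lyapunov_injective:
  assumes hw: "hurwitz A" and A: "A \<in> carrier_mat N N" and X: "X \<in> carrier_mat N N"
    and eq: "A * X + X * A\<^sup>T = 0\<^sub>m N N"
  shows "X = 0\<^sub>m N N"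
proof -
  let ?h = "map_mat complex_of_real"
  have neg: "A * X = X * (- A\<^sup>T)"
  proof (rule eq_matI)
    fix i j assume ij: "i < dim_row (X * (- A\<^sup>T))" "j < dim_col (X * (- A\<^sup>T))"
    have "(A * X + X * A\<^sup>T) $$ (i,j) = 0"
      using eq ij A X by simp
    then show "(A * X) $$ (i,j) = (X * (- A\<^sup>T)) $$ (i,j)"
      using ij A X by simp
  qed (use A X in auto)
  have hm: "?h (U * V) = ?h U * ?h V" if "U \<in> carrier_mat N N" "V \<in> carrier_mat N N" for U V
    using of_real_hom.mat_hom_mult[OF that] .
  have eqc: "?h A * ?h X = ?h X * (- (?h A)\<^sup>T)"
  proof -
    have "?h (- A\<^sup>T) = - (?h A)\<^sup>T" using A by (intro eq_matI) auto
    then show ?thesis using hm[of A X] hm[of X "- A\<^sup>T"] A X neg by simp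
  qed
  have ev: "eigenvalue (?h A) (- k)" if k: "eigenvalue (- (?h A)\<^sup>T) k" for k
  proof -
    obtain v where "eigenvector (- (?h A)\<^sup>T) v k"
      using k unfolding eigenvalue_def by auto
    then have v: "v \<in> carrier_vec N" "v \<noteq> 0\<^sub>v N" "- (?h A)\<^sup>T *\<^sub>v v = k \<cdot>\<^sub>v v"
      using A unfolding eigenvector_def by simp_all
    have "(?h A)\<^sup>T *\<^sub>v v = (- k) \<cdot>\<^sub>v v"
    proof (rule eq_vecI)
      fix i assume i: "i < dim_vec ((- k) \<cdot>\<^sub>v v)"
      have "(- (?h A)\<^sup>T *\<^sub>v v) $ i = (k \<cdot>\<^sub>v v) $ i" using v(3) by simp
      then show "((?h A)\<^sup>T *\<^sub>v v) $ i = ((- k) \<cdot>\<^sub>v v) $ i"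
        using i v(1) A by (simp add: minus_equation_iff[of _ "k * _"])
    qed (use A v in auto)
    then have "eigenvalue (?h A)\<^sup>T (- k)"
      using v A unfolding eigenvalue_def eigenvector_def by auto
    then show ?thesis using eigenvalue_transpose[of "?h A" N] A by simp
  qed
  have "?h X = 0\<^sub>m N N"
  proof (rule sylvester_zero[OF _ _ _ eqc])
    fix k assume "eigenvalue (?h A) k" "eigenvalue (- (?h A)\<^sup>T) k"
    with ev[of k] hw have "Re k < 0" "Re (- k) < 0" unfolding hurwitz_def by blast+
    then show False by simp
  qed (use A X in auto)
  then have "?h X $$ (i,j) = 0" if "i < N" "j < N" for i j using that by simp
  then show ?thesis using X by (intro eq_matI) auto
qed

section \<open>The Lyapunov operator in coordinates: solvability and a quantitative inverse\<close>

text \<open>\<open>lyap_mat\<close> is the Kronecker matrix of \<open>X \<mapsto> A X + X A\<^sup>T\<close> in row-major coordinates.\<close>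

definition vecm :: "nat \<Rightarrow> real mat \<Rightarrow> real vec" where
  "vecm N X = vec (N * N) (\<lambda>r. X $$ (r div N, r mod N))"

definition lyap_mat :: "nat \<Rightarrow> real mat \<Rightarrow> real mat" where
  "lyap_mat N A = mat (N * N) (N * N) (\<lambda>(r,s).
     (if r mod N = s mod N then A $$ (r div N, s div N) else 0) +
     (if r div N = s div N then A $$ (r mod N, s mod N) else 0))"

lemma div_mod_bounds: "r < N * N \<Longrightarrow> r div N < N" "r < N * N \<Longrightarrow> r mod N < N" for r N :: nat
  by (simp add: less_mult_imp_div_less) (metis less_nat_zero_code mod_less_divisor mult_0 neq0_conv)

lemma sum_double_index: "(\<Sum>s<N * N. f s) = (\<Sum>k<N. \<Sum>l<N. f (k * N + l))" for f :: "nat \<Rightarrow> real"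
proof -
  have "sum f {k * N..<k * N + N} = (\<Sum>l<N. f (k * N + l))" for k
    using sum.shift_bounds_nat_ivl[of f 0 "k * N" N] by (simp add: atLeast0LessThan add.commute)
  then show ?thesis by (simp flip: sum.nat_group)
qed

lemma lyap_mat_vecm:
  assumes A: "A \<in> carrier_mat N N" and X: "X \<in> carrier_mat N N"
  shows "lyap_mat N A *\<^sub>v vecm N X = vecm N (A * X + X * A\<^sup>T)"
proof (rule eq_vecI)
  fix r assume "r < dim_vec (vecm N (A * X + X * A\<^sup>T))"
  then have r: "r < N * N" by (simp add: vecm_def)
  note b = div_mod_bounds[OF r]
  define i j where "i = r div N" and "j = r mod N"
  have ij: "i < N" "j < N" using b by (auto simp: i_def j_def)
  have "(lyap_mat N A *\<^sub>v vecm N X) $ r =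
      (\<Sum>s<N * N. ((if j = s mod N then A $$ (i, s div N) else 0) +
          (if i = s div N then A $$ (j, s mod N) else 0)) * X $$ (s div N, s mod N))"
    using r unfolding i_def j_def by (simp add: lyap_mat_def vecm_def scalar_prod_def atLeast0LessThan)
  \<comment> \<open>Writing \<open>s = k * N + l\<close> separates the two Kronecker deltas; each of
    them collapses one of the two sums.\<close>
  also have "\<dots> = (\<Sum>k<N. \<Sum>l<N. ((if j = l then A $$ (i,k) else 0) + (if i = k then A $$ (j,l) else 0)) * X $$ (k,l))"
    unfolding sum_double_index by (intro sum.cong refl) auto
  also have "\<dots> = (\<Sum>k<N. \<Sum>l<N. if j = l then A $$ (i,k) * X $$ (k,l) else 0)
      + (\<Sum>k<N. \<Sum>l<N. if i = k then A $$ (j,l) * X $$ (k,l) else 0)"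
    unfolding sum.distrib[symmetric] by (intro sum.cong refl) (auto simp: algebra_simps)
  also have "(\<Sum>k<N. \<Sum>l<N. if j = l then A $$ (i,k) * X $$ (k,l) else 0) = (\<Sum>k<N. A $$ (i,k) * X $$ (k,j))"
    using ij by (simp add: sum.delta')
  also have "(\<Sum>k<N. \<Sum>l<N. if i = k then A $$ (j,l) * X $$ (k,l) else 0) = (\<Sum>l<N. A $$ (j,l) * X $$ (i,l))"
    using ij by (subst sum.swap) (simp add: sum.delta')
  also have "(\<Sum>k<N. A $$ (i,k) * X $$ (k,j)) + (\<Sum>l<N. A $$ (j,l) * X $$ (i,l)) = (A * X + X * A\<^sup>T) $$ (i,j)"
    using ij A X by (simp add: index_mult_sum mult.commute del: index_mult_mat(1))
  also have "\<dots> = vecm N (A * X + X * A\<^sup>T) $ r"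
    using r by (simp add: vecm_def i_def j_def)
  finally show "(lyap_mat N A *\<^sub>v vecm N X) $ r = vecm N (A * X + X * A\<^sup>T) $ r" .
qed (simp add: lyap_mat_def vecm_def)

lemma pair_index_less:
  assumes "i < N" "j < (N::nat)"
  shows "i * N + j < N * N"
proof -
  have "i * N + j < Suc i * N" using assms by simp
  also have "\<dots> \<le> N * N" using assms by (intro mult_le_mono1) simp
  finally show ?thesis .
qed

lemma vecm_index: "i < N \<Longrightarrow> j < N \<Longrightarrow> vecm N X $ (i * N + j) = X $$ (i,j)"
  by (simp add: vecm_def pair_index_less)

lemma vecm_inject:
  "X \<in> carrier_mat N N \<Longrightarrow> Y \<in> carrier_mat N N \<Longrightarrow> vecm N X = vecm N Y \<Longrightarrow> X = Y"
  by (rule eq_matI) (auto simp: vecm_index[symmetric])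

lemma vecm_surj: "v \<in> carrier_vec (N * N) \<Longrightarrow> \<exists>X \<in> carrier_mat N N. vecm N X = v"
  by (intro bexI[of _ "mat N N (\<lambda>(i,j). v $ (i * N + j))"] eq_vecI)
     (auto simp: vecm_def div_mod_bounds)

lemma vecm_zero: "vecm N (0\<^sub>m N N) = 0\<^sub>v (N * N)"
  by (rule eq_vecI) (auto simp: vecm_def div_mod_bounds)

text \<open>Injectivity makes the square Kronecker matrix invertible, and its inverse
  \<open>Ki\<close> gives both solvability and the lower bound. The hypothesis is injectivity rather
  than stability because the solvability part is also applied to perturbed matrices, whose spectrum
  is not studied.\<close>

lemma lyapunov_inverse:
  assumes A: "A \<in> carrier_mat N N"
    and inj: "\<And>X. X \<in> carrier_mat N N \<Longrightarrow> A * X + X * A\<^sup>T = 0\<^sub>m N N \<Longrightarrow> X = 0\<^sub>m N N"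
  shows lyapunov_surj: "W \<in> carrier_mat N N \<Longrightarrow> \<exists>X \<in> carrier_mat N N. A * X + X * A\<^sup>T = W"
    and lyapunov_bounded_below: "\<exists>\<kappa>>0. \<forall>X \<in> carrier_mat N N. nrm X \<le> \<kappa> * nrm (A * X + X * A\<^sup>T)"
proof -
  define K where "K = lyap_mat N A"
  have K: "K \<in> carrier_mat (N * N) (N * N)" by (simp add: K_def lyap_mat_def)
  have L: "A * X + X * A\<^sup>T \<in> carrier_mat N N" if "X \<in> carrier_mat N N" for X
    using A that by auto
  have "det K \<noteq> 0"
  proof
    assume "det K = 0"
    then obtain v where v: "v \<in> carrier_vec (N * N)" "v \<noteq> 0\<^sub>v (N * N)" "K *\<^sub>v v = 0\<^sub>v (N * N)"
      using det_0_iff_vec_prod_zero[OF K] by auto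
    obtain X where X: "X \<in> carrier_mat N N" "vecm N X = v" using vecm_surj[OF v(1)] by auto
    have "vecm N (A * X + X * A\<^sup>T) = vecm N (0\<^sub>m N N)"
      using lyap_mat_vecm[OF A X(1)] v(3) X(2) by (simp add: K_def vecm_zero)
    then have "A * X + X * A\<^sup>T = 0\<^sub>m N N" using vecm_inject[OF L[OF X(1)]] by simp
    then have "X = 0\<^sub>m N N" using inj[OF X(1)] by simp
    with X(2) v(2) show False by (simp add: vecm_zero)
  qed
  then obtain Ki where Ki: "Ki \<in> carrier_mat (N * N) (N * N)" "Ki * K = 1\<^sub>m (N * N)" "K * Ki = 1\<^sub>m (N * N)"
    using det_non_zero_imp_unit[OF K, of "()"] unfolding Units_def ring_mat_def by auto
  show "\<exists>X \<in> carrier_mat N N. A * X + X * A\<^sup>T = W" if W: "W \<in> carrier_mat N N"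
  proof -
    have vW: "vecm N W \<in> carrier_vec (N * N)" by (simp add: vecm_def)
    obtain X where X: "X \<in> carrier_mat N N" "vecm N X = Ki *\<^sub>v vecm N W"
      using vecm_surj[of "Ki *\<^sub>v vecm N W" N] Ki(1) vW by auto
    have "vecm N (A * X + X * A\<^sup>T) = K * Ki *\<^sub>v vecm N W"
      using lyap_mat_vecm[OF A X(1)] X(2) assoc_mult_mat_vec[OF K Ki(1) vW] by (simp add: K_def)
    also have "\<dots> = vecm N W" using vW by (simp add: Ki(3))
    finally show ?thesis using vecm_inject[OF L[OF X(1)] W] X(1) by auto
  qed
  \<comment> \<open>Each of the \<open>N * N\<close> entries of \<open>X\<close> is at most
    \<open>nrm Ki * nrm ?L\<close>; the added 1 makes the constant strictly positive.\<close>
  have "nrm X \<le> (real (N * N) * nrm Ki + 1) * nrm (A * X + X * A\<^sup>T)" if X: "X \<in> carrier_mat N N" for X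
  proof -
    let ?L = "A * X + X * A\<^sup>T"
    have vX: "vecm N X \<in> carrier_vec (N * N)" by (simp add: vecm_def)
    have "vecm N X = Ki * K *\<^sub>v vecm N X" using vX by (simp add: Ki(2))
    also have "\<dots> = Ki *\<^sub>v vecm N ?L"
      using lyap_mat_vecm[OF A X] assoc_mult_mat_vec[OF Ki(1) K vX] by (simp add: K_def)
    finally have eq: "vecm N X = Ki *\<^sub>v vecm N ?L" .
    have ent: "\<bar>X $$ (i,j)\<bar> \<le> nrm Ki * nrm ?L" if ij: "i < N" "j < N" for i j
    proof -
      have r: "i * N + j < N * N" using ij by (rule pair_index_less)
      have "X $$ (i,j) = (Ki *\<^sub>v vecm N ?L) $ (i * N + j)"
        unfolding eq[symmetric] vecm_index[OF ij] ..
      also have "\<dots> = (\<Sum>s<N * N. Ki $$ (i * N + j, s) * ?L $$ (s div N, s mod N))"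
        using r Ki(1) by (simp add: scalar_prod_def vecm_def atLeast0LessThan)
      finally have "\<bar>X $$ (i,j)\<bar> \<le> (\<Sum>s<N * N. \<bar>Ki $$ (i * N + j, s)\<bar> * \<bar>?L $$ (s div N, s mod N)\<bar>)"
        by (auto simp: abs_mult[symmetric] intro!: sum_abs)
      also have "\<dots> \<le> (\<Sum>s<N * N. \<bar>Ki $$ (i * N + j, s)\<bar> * nrm ?L)"
        using div_mod_bounds[of _ N] A X
        by (intro sum_mono mult_left_mono entry_le_nrm) auto
      also have "\<dots> \<le> nrm Ki * nrm ?L"
        unfolding sum_distrib_right[symmetric]
        using r Ki(1) member_le_sum[of "i * N + j" "{..<N * N}" "\<lambda>i. \<Sum>s<N * N. \<bar>Ki $$ (i, s)\<bar>"]
        by (intro mult_right_mono nrm_nonneg) (auto simp: nrm_def sum_nonneg)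
      finally show ?thesis .
    qed
    have "nrm X \<le> (\<Sum>i<N. \<Sum>j<N. nrm Ki * nrm ?L)"
      using X unfolding nrm_def[of X] carrier_matD[OF X] by (intro sum_mono ent) auto
    also have "\<dots> \<le> (real (N * N) * nrm Ki + 1) * nrm ?L"
      using nrm_nonneg[of ?L] by (simp add: algebra_simps)
    finally show ?thesis .
  qed
  then show "\<exists>\<kappa>>0. \<forall>X \<in> carrier_mat N N. nrm X \<le> \<kappa> * nrm (A * X + X * A\<^sup>T)"
    by (intro exI[of _ "real (N * N) * nrm Ki + 1"]) (auto simp: nrm_nonneg add_nonneg_pos)
qed

subsection \<open>Perturbation of the quadratic cost\<close>

text \<open>This is what makes the definite descriptions \<open>gramP\<close> and
  \<open>gramQ\<close> denote, at the base point and near it.\<close>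

lemma lyapunov_unique_solution:
  fixes A W :: "real mat"
  assumes A: "A \<in> carrier_mat N N" and W: "W \<in> carrier_mat N N"
    and inj: "\<And>X. X \<in> carrier_mat N N \<Longrightarrow> A * X + X * A\<^sup>T = 0\<^sub>m N N \<Longrightarrow> X = 0\<^sub>m N N"
  shows "\<exists>!X. X \<in> carrier_mat N N \<and> A * X + X * A\<^sup>T + W = 0\<^sub>m N N"
proof (rule ex_ex1I)
  obtain X where X: "X \<in> carrier_mat N N" "A * X + X * A\<^sup>T = - W"
    using lyapunov_surj[OF A inj, of "- W"] W by auto
  then show "\<exists>X. X \<in> carrier_mat N N \<and> A * X + X * A\<^sup>T + W = 0\<^sub>m N N"
    using W by (intro exI[of _ X]) auto
next
  fix X Y
  assume "X \<in> carrier_mat N N \<and> A * X + X * A\<^sup>T + W = 0\<^sub>m N N"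
    and "Y \<in> carrier_mat N N \<and> A * Y + Y * A\<^sup>T + W = 0\<^sub>m N N"
  then have X: "X \<in> carrier_mat N N" and Y: "Y \<in> carrier_mat N N"
    and XY: "A * X + X * A\<^sup>T + W = A * Y + Y * A\<^sup>T + W" by auto
  have "A * (X + - Y) + (X + - Y) * A\<^sup>T = 0\<^sub>m N N"
  proof (rule eq_matI)
    fix i j assume ij: "i < dim_row (0\<^sub>m N N)" "j < dim_col (0\<^sub>m N N)"
    have "(A * X + X * A\<^sup>T + W) $$ (i,j) = (A * Y + Y * A\<^sup>T + W) $$ (i,j)" using XY by simp
    then show "(A * (X + - Y) + (X + - Y) * A\<^sup>T) $$ (i,j) = 0\<^sub>m N N $$ (i,j)"
      using ij A X Y W
      by (simp add: mult_add_dim add_mult_dim del: index_mult_mat(1))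
  qed (use A X Y in auto)
  then have Z: "X + - Y = 0\<^sub>m N N" using X Y inj[of "X + - Y"] by simp
  show "X = Y"
  proof (rule eq_matI)
    fix i j assume ij: "i < dim_row Y" "j < dim_col Y"
    have "(X + - Y) $$ (i,j) = 0" using Z ij Y by simp
    then show "X $$ (i,j) = Y $$ (i,j)" using ij X Y by simp
  qed (use X Y in auto)
qed

text \<open>Transposing the equation shows that the transpose of a solution is again a solution;
  uniqueness finishes.\<close>

lemma lyapunov_solution_symmetric:
  fixes A W :: "real mat"
  assumes A: "A \<in> carrier_mat N N" and W: "W \<in> carrier_mat N N" "W\<^sup>T = W"
    and inj: "\<And>X. X \<in> carrier_mat N N \<Longrightarrow> A * X + X * A\<^sup>T = 0\<^sub>m N N \<Longrightarrow> X = 0\<^sub>m N N"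
    and X: "X \<in> carrier_mat N N" "A * X + X * A\<^sup>T + W = 0\<^sub>m N N"
  shows "X\<^sup>T = X"
proof -
  have "(A * X + X * A\<^sup>T + W)\<^sup>T = 0\<^sub>m N N" by (simp add: X(2))
  then have "X\<^sup>T * A\<^sup>T + A * X\<^sup>T + W = 0\<^sub>m N N"
    using A W X(1) by (simp add: transpose_add_dim transpose_mult_dim)
  then have "A * X\<^sup>T + X\<^sup>T * A\<^sup>T + W = 0\<^sub>m N N"
    using A X(1) by (simp add: comm_add_mat[of "A * X\<^sup>T" N N])
  then show ?thesis
    using lyapunov_unique_solution[OF A W(1) inj] X by (metis transpose_carrier_mat)
qed

text \<open>Moving the terms with \<open>dA\<close> to the right gives nrm X <= kappa (2 nrm dA nrm
  X + nrm W). Smallness makes the coefficient of nrm X on the right at most 1/2, so it is absorbed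
  at the price of the factor 2.\<close>

lemma lyapunov_perturbed_bound:
  assumes A: "A \<in> carrier_mat N N" and dA: "dA \<in> carrier_mat N N" and W: "W \<in> carrier_mat N N"
    and \<kappa>: "\<And>X. X \<in> carrier_mat N N \<Longrightarrow> nrm X \<le> \<kappa> * nrm (A * X + X * A\<^sup>T)" "0 < \<kappa>"
    and small: "4 * \<kappa> * nrm dA \<le> 1"
    and X: "X \<in> carrier_mat N N" "(A + dA) * X + X * (A + dA)\<^sup>T + W = 0\<^sub>m N N"
  shows "nrm X \<le> 2 * \<kappa> * nrm W"
proof -
  let ?E = "dA * X + X * dA\<^sup>T + W"
  have eq: "A * X + X * A\<^sup>T = - ?E"
  proof (rule eq_matI)
    fix i j assume ij: "i < dim_row (- ?E)" "j < dim_col (- ?E)"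
    have "((A + dA) * X + X * (A + dA)\<^sup>T + W) $$ (i,j) = 0" using X(2) ij W by simp
    then show "(A * X + X * A\<^sup>T) $$ (i,j) = (- ?E) $$ (i,j)"
      using ij A X(1) W dA
      by (simp add: mult_add_dim add_mult_dim transpose_add_dim del: index_mult_mat(1))
  qed (use A X W in auto)
  have "nrm ?E \<le> nrm (dA * X) + nrm (X * dA\<^sup>T) + nrm W"
    using dA X W nrm_add[of "dA * X + X * dA\<^sup>T" W] nrm_add[of "dA * X" "X * dA\<^sup>T"] by simp
  also have "nrm (dA * X) \<le> nrm dA * nrm X"
    using dA X by (intro nrm_mult) auto
  also have "nrm (X * dA\<^sup>T) \<le> nrm dA * nrm X"
    using dA X nrm_mult[of X "dA\<^sup>T"] by (simp add: nrm_transpose mult.commute)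
  finally have "\<kappa> * nrm ?E \<le> \<kappa> * (nrm dA * nrm X + nrm dA * nrm X + nrm W)"
    using \<kappa>(2) by simp
  with \<kappa>(1)[OF X(1)] have "nrm X \<le> \<kappa> * (nrm dA * nrm X + nrm dA * nrm X + nrm W)"
    by (simp add: eq nrm_uminus del: minus_add_distrib)
  moreover have "4 * \<kappa> * nrm dA * nrm X \<le> 1 * nrm X"
    using small by (intro mult_right_mono nrm_nonneg)
  ultimately show ?thesis by (simp add: algebra_simps)
qed

text \<open>The case W = 0 of the preceding bound. It stands in for stability of the perturbed
  matrix.\<close>

lemma lyapunov_perturbed_injective:
  assumes A: "A \<in> carrier_mat N N" and dA: "dA \<in> carrier_mat N N"
    and \<kappa>: "\<And>X. X \<in> carrier_mat N N \<Longrightarrow> nrm X \<le> \<kappa> * nrm (A * X + X * A\<^sup>T)" "0 < \<kappa>"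
    and small: "4 * \<kappa> * nrm dA \<le> 1"
    and X: "X \<in> carrier_mat N N" "(A + dA) * X + X * (A + dA)\<^sup>T = 0\<^sub>m N N"
  shows "X = 0\<^sub>m N N"
proof -
  have "nrm X \<le> 2 * \<kappa> * nrm (0\<^sub>m N N)"
    using X by (intro lyapunov_perturbed_bound[OF A dA _ \<kappa> small]) auto
  then have "nrm X = 0" using nrm_nonneg[of X] by (simp add: nrm_zero)
  then show ?thesis using nrm_eq_0D[of X] X by simp
qed

text \<open>X |-> A X + X A^T and Q |-> A^T Q + Q A are adjoint for the Frobenius product.\<close>

lemma lyapunov_duality:
  assumes "A \<in> carrier_mat N N" "Q \<in> carrier_mat N N" "X \<in> carrier_mat N N" "V \<in> carrier_mat N N"
    and "A\<^sup>T * Q + Q * A + V = 0\<^sub>m N N"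
  shows "ip V X = - ip Q (A * X + X * A\<^sup>T)"
proof -
  have "ip Q (A * X + X * A\<^sup>T) + ip V X = ip (A\<^sup>T * Q + Q * A + V) X"
    using assms(1-4)
    by (simp add: ip_add_left ip_add_right ip_mult_right[of _ A X] ip_mult_right'[of _ X "A\<^sup>T"])
  also have "\<dots> = 0" unfolding assms(5) by (simp add: ip_def)
  finally show ?thesis by simp
qed

text \<open>An exact identity, with no smallness assumed. The last line of the conclusion collects
  what will be of second order. Symmetry of \<open>Q\<close> and of \<open>P + dP\<close> merges
  each mixed term with its transpose, which produces the factors 2.\<close>

lemma lyapunov_cost_difference:
  assumes A: "A \<in> carrier_mat N N" "dA \<in> carrier_mat N N"
    and B: "B \<in> carrier_mat N m" "dB \<in> carrier_mat N m"
    and C: "C \<in> carrier_mat q N" "dC \<in> carrier_mat q N"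
    and P: "P \<in> carrier_mat N N" "A * P + P * A\<^sup>T + B * B\<^sup>T = 0\<^sub>m N N"
    and Q: "Q \<in> carrier_mat N N" "Q\<^sup>T = Q" "A\<^sup>T * Q + Q * A + C\<^sup>T * C = 0\<^sub>m N N"
    and dP: "dP \<in> carrier_mat N N" "(P + dP)\<^sup>T = P + dP"
      "(A + dA) * (P + dP) + (P + dP) * (A + dA)\<^sup>T + (B + dB) * (B + dB)\<^sup>T = 0\<^sub>m N N"
  shows "ip ((C + dC)\<^sup>T * (C + dC)) (P + dP) - ip (C\<^sup>T * C) P
      = 2 * (ip (Q * P) dA + ip (Q * B) dB + ip (C * P) dC)
      + 2 * ip (Q * dP) dA + ip Q (dB * dB\<^sup>T) + 2 * ip (C * dP) dC + ip (dC\<^sup>T * dC) (P + dP)"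
proof -
  define P' where "P' = P + dP"
  have P': "P' \<in> carrier_mat N N" "P'\<^sup>T = P'"
    "(A + dA) * P' + P' * (A + dA)\<^sup>T + (B + dB) * (B + dB)\<^sup>T = 0\<^sub>m N N"
    using P dP by (auto simp: P'_def)
  note carr = A B C P(1) Q(1) P'(1) dP(1)
  have "ip Q ((A + dA) * P' + P' * (A + dA)\<^sup>T + (B + dB) * (B + dB)\<^sup>T) = 0"
    using P'(3) Q(1) by (simp add: ip_def)
  then have 1: "ip Q (A * P' + P' * A\<^sup>T) + ip Q (dA * P') + ip Q (P' * dA\<^sup>T) + ip Q (B * B\<^sup>T)
      + ip Q (B * dB\<^sup>T) + ip Q (dB * B\<^sup>T) + ip Q (dB * dB\<^sup>T) = 0"
    using carr by (simp add: transpose_add_dim mult_add_dim add_mult_dim ip_add_right)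
  have "ip Q (A * P + P * A\<^sup>T + B * B\<^sup>T) = 0"
    using P(2) Q(1) by (simp add: ip_def)
  then have 2: "ip Q (A * P + P * A\<^sup>T) + ip Q (B * B\<^sup>T) = 0"
    using carr by (simp add: ip_add_right)
  have 3: "ip Q (dA * P') = ip (Q * P') dA"
    using carr P'(2) by (subst ip_mult_right') simp_all
  have 4: "ip Q (P' * dA\<^sup>T) = ip (Q * P') dA"
    using carr P'(2) Q(2)
    by (subst ip_mult_right) (simp_all add: transpose_mult_dim flip: ip_transpose[of "P' * Q"])
  have 5: "ip Q (dB * B\<^sup>T) = ip (Q * B) dB"
    using carr by (subst ip_mult_right') simp_all
  have 6: "ip Q (B * dB\<^sup>T) = ip (Q * B) dB"
    using carr Q(2)
    by (subst ip_mult_right) (simp_all add: transpose_mult_dim flip: ip_transpose[of "B\<^sup>T * Q"])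
  have 7: "ip (C\<^sup>T * dC) P' = ip (C * P') dC"
    using carr by (subst ip_commute) (simp_all add: ip_mult_right)
  have 8: "ip (dC\<^sup>T * C) P' = ip (C * P') dC"
    using carr P'(2)
    by (subst ip_commute) (simp_all add: ip_mult_right' transpose_mult_dim flip: ip_transpose[of "P' * C\<^sup>T"])
  have 9: "ip ((C + dC)\<^sup>T * (C + dC)) P' = ip (C\<^sup>T * C) P' + ip (C\<^sup>T * dC) P' + ip (dC\<^sup>T * C) P' + ip (dC\<^sup>T * dC) P'"
    using carr by (simp add: transpose_add_dim mult_add_dim add_mult_dim ip_add_left)
  have 10: "ip (C\<^sup>T * C) X = - ip Q (A * X + X * A\<^sup>T)" if "X \<in> carrier_mat N N" for X
    using carr that Q(3) by (intro lyapunov_duality) auto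
  have 11: "ip (Q * P') dA = ip (Q * P) dA + ip (Q * dP) dA" "ip (C * P') dC = ip (C * P) dC + ip (C * dP) dC"
    using carr by (simp_all add: P'_def mult_add_dim ip_add_left)
  show ?thesis
    unfolding P'_def[symmetric]
    using 1 2 10[OF P'(1)] 10[OF P(1)] unfolding 3 4 5 6 7 8 9 11 by argo
qed

text \<open>Envelope formula: the derivative of \<open>P\<close> does not enter the first-order change of the cost.\<close>

theorem lyapunov_cost_expansion:
  assumes hw: "hurwitz A" and A: "A \<in> carrier_mat N N" and B: "B \<in> carrier_mat N m" and C: "C \<in> carrier_mat q N"
    and P: "P \<in> carrier_mat N N" "A * P + P * A\<^sup>T + B * B\<^sup>T = 0\<^sub>m N N"
    and Q: "Q \<in> carrier_mat N N" "A\<^sup>T * Q + Q * A + C\<^sup>T * C = 0\<^sub>m N N"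
  shows "\<exists>\<delta>>0. \<exists>K\<ge>0. \<forall>dA \<in> carrier_mat N N. \<forall>dB \<in> carrier_mat N m. \<forall>dC \<in> carrier_mat q N. \<forall>d<\<delta>.
     nrm dA \<le> d \<and> nrm dB \<le> d \<and> nrm dC \<le> d \<longrightarrow>
     (\<exists>!P'. P' \<in> carrier_mat N N \<and>
        (A + dA) * P' + P' * (A + dA)\<^sup>T + (B + dB) * (B + dB)\<^sup>T = 0\<^sub>m N N) \<and>
     (\<forall>P' \<in> carrier_mat N N.
        (A + dA) * P' + P' * (A + dA)\<^sup>T + (B + dB) * (B + dB)\<^sup>T = 0\<^sub>m N N \<longrightarrow>
        \<bar>ip ((C + dC)\<^sup>T * (C + dC)) P' - ip (C\<^sup>T * C) P
          - 2 * (ip (Q * P) dA + ip (Q * B) dB + ip (C * P) dC)\<bar> \<le> K * d\<^sup>2)"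
proof -
  note inj = lyapunov_injective[OF hw A]
  obtain \<kappa> where \<kappa>0: "\<kappa> > 0" and \<kappa>: "\<And>X. X \<in> carrier_mat N N \<Longrightarrow> nrm X \<le> \<kappa> * nrm (A * X + X * A\<^sup>T)"
    using lyapunov_bounded_below[OF A inj] by auto
  have At: "A\<^sup>T \<in> carrier_mat N N" using A by simp
  have Qs: "Q\<^sup>T = Q"
  proof (rule lyapunov_solution_symmetric[OF At])
    show "C\<^sup>T * C \<in> carrier_mat N N" "(C\<^sup>T * C)\<^sup>T = C\<^sup>T * C"
      using C by (simp_all add: transpose_mult_dim)
    show "A\<^sup>T * Q + Q * A\<^sup>T\<^sup>T + C\<^sup>T * C = 0\<^sub>m N N" using Q(2) by simp
  qed (use Q(1) lyapunov_injective[OF hurwitz_transpose[OF hw] At] in auto)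
  \<comment> \<open>\<open>p\<close> bounds the perturbed solution, because
    \<open>nrm (B + dB) \<le> \<beta> + 1\<close>. \<open>k1 * d\<close> bounds \<open>dP\<close>:
    2p comes from the two terms with \<open>dA\<close>, 2 beta from the cross terms of B and dB, and
    1 from \<open>dB * dB\<^sup>T\<close>. \<open>K\<close> adds the bounds of the four remainder
    terms. In \<open>\<delta>\<close> the bound 1 allows d^2 to be replaced by d, and the other one
    is the smallness condition of \<open>lyapunov_perturbed_bound\<close>.\<close>
  define \<beta> p k1 K \<delta> where "\<beta> = nrm B" and "p = 2 * \<kappa> * (\<beta> + 1)\<^sup>2" and "k1 = \<kappa> * (2 * p + 2 * \<beta> + 1)"
    and "K = 2 * nrm Q * k1 + nrm Q + 2 * nrm C * k1 + p" and "\<delta> = min 1 (1 / (4 * \<kappa>))"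
  have \<beta>0: "\<beta> \<ge> 0" by (simp add: \<beta>_def nrm_nonneg)
  then have p0: "p \<ge> 0" using \<kappa>0 by (simp add: p_def)
  then have k10: "k1 \<ge> 0" using \<kappa>0 \<beta>0 by (simp add: k1_def)
  have K0: "K \<ge> 0" using p0 k10 by (simp add: K_def nrm_nonneg)
  have main: "(\<exists>!P'. P' \<in> carrier_mat N N \<and>
        (A + dA) * P' + P' * (A + dA)\<^sup>T + (B + dB) * (B + dB)\<^sup>T = 0\<^sub>m N N) \<and>
     (\<forall>P' \<in> carrier_mat N N.
        (A + dA) * P' + P' * (A + dA)\<^sup>T + (B + dB) * (B + dB)\<^sup>T = 0\<^sub>m N N \<longrightarrow>
        \<bar>ip ((C + dC)\<^sup>T * (C + dC)) P' - ip (C\<^sup>T * C) P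
          - 2 * (ip (Q * P) dA + ip (Q * B) dB + ip (C * P) dC)\<bar> \<le> K * d\<^sup>2)"
    if dA: "dA \<in> carrier_mat N N" and dB: "dB \<in> carrier_mat N m" and dC: "dC \<in> carrier_mat q N"
      and d: "d < \<delta>" and nA: "nrm dA \<le> d" and nB: "nrm dB \<le> d" and nC: "nrm dC \<le> d"
    for dA dB dC d
  proof -
    have d0: "d \<ge> 0" using nA nrm_nonneg[of dA] by linarith
    have d1: "d \<le> 1" using d by (simp add: \<delta>_def)
    have "d \<le> 1 / (4 * \<kappa>)" using d by (simp add: \<delta>_def)
    then have \<kappa>d: "4 * \<kappa> * d \<le> 1" using \<kappa>0 by (simp add: field_simps)
    have "4 * \<kappa> * nrm dA \<le> 4 * \<kappa> * d" using nA \<kappa>0 by simp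
    then have small: "4 * \<kappa> * nrm dA \<le> 1" using \<kappa>d by linarith
    have AdA: "A + dA \<in> carrier_mat N N" using A dA by simp
    let ?W = "(B + dB) * (B + dB)\<^sup>T"
    have W: "?W \<in> carrier_mat N N" "?W\<^sup>T = ?W" using B dB by (auto simp: transpose_mult_dim)
    note inj' = lyapunov_perturbed_injective[OF A dA \<kappa> \<kappa>0 small]
    have nBB: "nrm (B + dB) \<le> \<beta> + 1"
      using nrm_add[of B dB] B dB nB d1 by (simp add: \<beta>_def)
    have "nrm ?W \<le> nrm (B + dB) * nrm (B + dB)"
      using B dB nrm_mult[of "B + dB" "(B + dB)\<^sup>T"] by (simp add: nrm_transpose)
    also have "\<dots> \<le> (\<beta> + 1) * (\<beta> + 1)"
      using nBB \<beta>0 by (intro mult_mono nrm_nonneg) auto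
    finally have nW: "nrm ?W \<le> (\<beta> + 1)\<^sup>2" by (simp add: power2_eq_square)
    have "\<bar>ip ((C + dC)\<^sup>T * (C + dC)) P' - ip (C\<^sup>T * C) P
          - 2 * (ip (Q * P) dA + ip (Q * B) dB + ip (C * P) dC)\<bar> \<le> K * d\<^sup>2"
      if P': "P' \<in> carrier_mat N N" "(A + dA) * P' + P' * (A + dA)\<^sup>T + ?W = 0\<^sub>m N N" for P'
    proof -
      have P's: "P'\<^sup>T = P'"
        by (rule lyapunov_solution_symmetric[OF AdA W inj' P'])
      have "nrm P' \<le> 2 * \<kappa> * nrm ?W"
        by (rule lyapunov_perturbed_bound[OF A dA W(1) \<kappa> \<kappa>0 small P'])
      also have "\<dots> \<le> p"
        using nW \<kappa>0 by (simp add: p_def)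
      finally have nP': "nrm P' \<le> p" .
      define dP where "dP = P' + - P"
      have dP: "dP \<in> carrier_mat N N" using P' P by (auto simp: dP_def)
      have P'_eq: "P' = P + dP" using P P' by (intro eq_matI) (auto simp: dP_def)
      \<comment> \<open>Subtracting the two Lyapunov equations shows that \<open>dP\<close> solves
        an unperturbed one whose right side is of order d, so the lower bound for the unperturbed
        operator controls it.\<close>
      let ?E = "dA * P' + P' * dA\<^sup>T + (B * dB\<^sup>T + dB * B\<^sup>T + dB * dB\<^sup>T)"
      have eq: "A * dP + dP * A\<^sup>T = - ?E"
      proof (rule eq_matI)
        fix i j assume ij: "i < dim_row (- ?E)" "j < dim_col (- ?E)"
        have "((A + dA) * P' + P' * (A + dA)\<^sup>T + ?W) $$ (i,j) = (A * P + P * A\<^sup>T + B * B\<^sup>T) $$ (i,j)"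
          using P P' by simp
        then show "(A * dP + dP * A\<^sup>T) $$ (i,j) = (- ?E) $$ (i,j)"
          using ij A P(1) P'(1) B dB dA
          by (simp add: dP_def mult_add_dim add_mult_dim transpose_add_dim del: index_mult_mat(1))
      qed (use A dP B dB in auto)
      have "nrm ?E \<le> nrm (dA * P') + nrm (P' * dA\<^sup>T) + (nrm (B * dB\<^sup>T) + nrm (dB * B\<^sup>T) + nrm (dB * dB\<^sup>T))"
        using dA P'(1) B dB
          nrm_add[of "dA * P' + P' * dA\<^sup>T" "B * dB\<^sup>T + dB * B\<^sup>T + dB * dB\<^sup>T"]
          nrm_add[of "dA * P'" "P' * dA\<^sup>T"]
          nrm_add[of "B * dB\<^sup>T + dB * B\<^sup>T" "dB * dB\<^sup>T"] nrm_add[of "B * dB\<^sup>T" "dB * B\<^sup>T"] by simp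
      also have "nrm (dA * P') \<le> d * p"
        using dA P'(1) nA nP' d0
        by (intro order_trans[OF nrm_mult] mult_mono nrm_nonneg) auto
      also have "nrm (P' * dA\<^sup>T) \<le> p * d"
        using dA P'(1) nA nP' p0
        by (intro order_trans[OF nrm_mult] mult_mono nrm_nonneg) (auto simp: nrm_transpose)
      also have "nrm (B * dB\<^sup>T) \<le> \<beta> * d"
        using B dB nB \<beta>0
        by (intro order_trans[OF nrm_mult] mult_mono nrm_nonneg) (auto simp: nrm_transpose \<beta>_def)
      also have "nrm (dB * B\<^sup>T) \<le> d * \<beta>"
        using B dB nB \<beta>0 d0
        by (intro order_trans[OF nrm_mult] mult_mono nrm_nonneg) (auto simp: nrm_transpose \<beta>_def)
      also have ndB: "nrm (dB * dB\<^sup>T) \<le> d * d"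
        using B dB nB d0
        by (intro order_trans[OF nrm_mult] mult_mono nrm_nonneg) (auto simp: nrm_transpose)
      also have "d * d \<le> d * 1"
        using d0 d1 by (intro mult_left_mono) auto
      finally have nE: "nrm ?E \<le> (2 * p + 2 * \<beta> + 1) * d" by (simp add: algebra_simps)
      have "nrm dP \<le> \<kappa> * nrm ?E"
        using \<kappa>[OF dP] unfolding eq nrm_uminus .
      also have "\<dots> \<le> \<kappa> * ((2 * p + 2 * \<beta> + 1) * d)"
        using nE \<kappa>0 by (intro mult_left_mono) auto
      finally have ndP: "nrm dP \<le> k1 * d" by (simp add: k1_def mult.assoc)
      have r1: "\<bar>ip (Q * dP) dA\<bar> \<le> nrm Q * (k1 * d) * d"
        using Q(1) dP dA nA ndP d0 k10
        by (intro order_trans[OF ip_le_nrm] mult_mono order_trans[OF nrm_mult] nrm_nonneg mult_nonneg_nonneg) auto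
      have r2: "\<bar>ip Q (dB * dB\<^sup>T)\<bar> \<le> nrm Q * (d * d)"
        using Q(1) dB ndB
        by (intro order_trans[OF ip_le_nrm] mult_left_mono nrm_nonneg) auto
      have r3: "\<bar>ip (C * dP) dC\<bar> \<le> nrm C * (k1 * d) * d"
        using C dP dC nC ndP d0 k10
        by (intro order_trans[OF ip_le_nrm] mult_mono order_trans[OF nrm_mult] nrm_nonneg mult_nonneg_nonneg) auto
      have r4: "\<bar>ip (dC\<^sup>T * dC) P'\<bar> \<le> (d * d) * p"
        using P'(1) dC nC nP' d0
        by (intro order_trans[OF ip_le_nrm] mult_mono order_trans[OF nrm_mult] nrm_nonneg mult_nonneg_nonneg)
          (auto simp: nrm_transpose)
      have "ip ((C + dC)\<^sup>T * (C + dC)) P' - ip (C\<^sup>T * C) P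
          = 2 * (ip (Q * P) dA + ip (Q * B) dB + ip (C * P) dC)
          + 2 * ip (Q * dP) dA + ip Q (dB * dB\<^sup>T) + 2 * ip (C * dP) dC + ip (dC\<^sup>T * dC) P'"
        unfolding P'_eq
        using P' P's unfolding P'_eq
        by (intro lyapunov_cost_difference[OF A dA B dB C dC P Q(1) Qs Q(2) dP]) auto
      moreover have "K * d\<^sup>2 = 2 * (nrm Q * (k1 * d) * d) + nrm Q * (d * d) + 2 * (nrm C * (k1 * d) * d) + (d * d) * p"
        by (simp add: K_def power2_eq_square algebra_simps)
      ultimately show ?thesis using r1 r2 r3 r4 by linarith
    qed
    then show ?thesis
      using lyapunov_unique_solution[OF AdA W(1) inj'] by blast
  qed
  have "\<delta> > 0" using \<kappa>0 by (simp add: \<delta>_def)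
  with main K0 show ?thesis by (intro exI[of _ \<delta>] conjI exI[of _ K] ballI allI impI) auto
qed

text \<open>On a ray t x with \<open>l x\<close> nonzero the homogeneous term of order t dominates
  the quadratic error, so an o(frob) bound is impossible. If \<open>l\<close> vanishes, the
  quadratic error is itself such a bound.\<close>

lemma first_order_criterion:
  fixes F l :: "real mat \<Rightarrow> real"
  assumes S: "S \<subseteq> carrier_mat r c" and cone: "\<And>t x. x \<in> S \<Longrightarrow> t \<cdot>\<^sub>m x \<in> S"
    and \<rho>: "\<rho> > 0" and K: "K \<ge> 0"
    and F: "\<And>x. x \<in> S \<Longrightarrow> nrm x < \<rho> \<Longrightarrow> \<bar>F x - l x\<bar> \<le> K * (nrm x)\<^sup>2"
    and l: "\<And>t x. x \<in> S \<Longrightarrow> l (t \<cdot>\<^sub>m x) = t * l x"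
  shows "(\<forall>\<epsilon>>0. \<exists>\<delta>>0. \<forall>x\<in>S. frob x < \<delta> \<longrightarrow> \<bar>F x\<bar> \<le> \<epsilon> * frob x) \<longleftrightarrow> (\<forall>x\<in>S. l x = 0)"
    (is "?L \<longleftrightarrow> ?R")
proof
  assume L: ?L
  show ?R
  proof (rule ballI, rule ccontr)
    fix x assume x: "x \<in> S" and nz: "l x \<noteq> 0"
    define M where "M = nrm x + 1"
    have M: "M > 0" "nrm x \<le> M" "frob x \<le> M"
      using nrm_nonneg[of x] frob_le_nrm[of x] by (auto simp: M_def)
    have "\<bar>l x\<bar> / (2 * M) > 0" using nz M by simp
    with L obtain \<delta> where \<delta>: "\<delta> > 0" "\<And>y. y \<in> S \<Longrightarrow> frob y < \<delta> \<Longrightarrow> \<bar>F y\<bar> \<le> \<bar>l x\<bar> / (2 * M) * frob y"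
      by blast
    \<comment> \<open>The three bounds place t x in the ball where the o(frob) bound holds, place it
      in the domain of the expansion, and make the quadratic error at most t |l x| / 4. The o(frob)
      bound gives t |l x| / 2, and the two together fall short of t |l x|.\<close>
    define t where "t = Min {\<delta> / (2 * M), \<rho> / (2 * M), \<bar>l x\<bar> / (4 * (K + 1) * M\<^sup>2)}"
    have t: "t > 0" "t \<le> \<delta> / (2 * M)" "t \<le> \<rho> / (2 * M)" "t \<le> \<bar>l x\<bar> / (4 * (K + 1) * M\<^sup>2)"
      using \<delta>(1) \<rho> M K nz by (auto simp: t_def)
    have "4 * (K + 1) * M\<^sup>2 > 0" using K M by simp
    then have "t * (4 * (K + 1) * M\<^sup>2) \<le> \<bar>l x\<bar>"
      using t(4) by (simp only: pos_le_divide_eq)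
    moreover have "t * M < \<delta>" "t * M < \<rho>"
      using t M \<delta>(1) \<rho> by (simp_all add: field_simps)
    ultimately have tM: "t * M < \<delta>" "t * M < \<rho>" "t * (4 * (K + 1) * M\<^sup>2) \<le> \<bar>l x\<bar>" by auto
    have tx: "t * nrm x \<le> t * M" "t * frob x \<le> t * M"
      using M t(1) by auto
    have "\<bar>F (t \<cdot>\<^sub>m x)\<bar> \<le> \<bar>l x\<bar> / (2 * M) * (t * frob x)"
      using \<delta>(2)[OF cone[OF x], of t] tM tx t(1) by (simp add: frob_smult)
    also have "\<dots> \<le> \<bar>l x\<bar> / (2 * M) * (t * M)"
      using tx M t(1) by (intro mult_left_mono) auto
    also have "\<dots> = t * \<bar>l x\<bar> / 2" using M by (simp add: field_simps)
    finally have 1: "\<bar>F (t \<cdot>\<^sub>m x)\<bar> \<le> t * \<bar>l x\<bar> / 2" .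
    have "\<bar>F (t \<cdot>\<^sub>m x) - t * l x\<bar> \<le> K * (t * nrm x)\<^sup>2"
      using F[OF cone[OF x], of t] l[OF x, of t] tM tx t(1) by (simp add: nrm_smult)
    also have "\<dots> \<le> K * (t * M)\<^sup>2"
      using tx t(1) nrm_nonneg[of x] K by (intro mult_left_mono power_mono) auto
    also have "\<dots> \<le> (K + 1) * (t * M)\<^sup>2" by (intro mult_right_mono) auto
    also have "\<dots> = t * (t * (4 * (K + 1) * M\<^sup>2)) / 4" by (simp add: power2_eq_square)
    also have "\<dots> \<le> t * \<bar>l x\<bar> / 4" using t(1) tM(3) by (intro divide_right_mono mult_left_mono) auto
    finally have 2: "\<bar>F (t \<cdot>\<^sub>m x) - t * l x\<bar> \<le> t * \<bar>l x\<bar> / 4" .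
    have "\<bar>t * l x\<bar> = t * \<bar>l x\<bar>" using t(1) by (simp add: abs_mult)
    moreover have "t * \<bar>l x\<bar> > 0" using t(1) nz by simp
    ultimately show False using 1 2 by linarith
  qed
next
  assume R: ?R
  show ?L
  proof (intro allI impI)
    fix \<epsilon> :: real assume \<epsilon>: "\<epsilon> > 0"
    define k where "k = real (r * c) + 1"
    have k: "k > 0" by (simp add: k_def add_nonneg_pos)
    \<comment> \<open>\<open>k\<close> converts the Frobenius norm into \<open>nrm\<close>. The
      first bound keeps x in the domain of the expansion, the second turns one factor of the
      quadratic error into epsilon.\<close>
    define \<delta> where "\<delta> = min (\<rho> / k) (\<epsilon> / ((K + 1) * k\<^sup>2))"
    have \<delta>: "\<delta> > 0" using \<rho> \<epsilon> k K by (simp add: \<delta>_def)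
    have "\<bar>F x\<bar> \<le> \<epsilon> * frob x" if x: "x \<in> S" "frob x < \<delta>" for x
    proof -
      have "nrm x \<le> real (r * c) * frob x" using nrm_le_frob[of x] S x(1) by auto
      also have "\<dots> \<le> k * frob x" using frob_nonneg[of x] by (intro mult_right_mono) (auto simp: k_def)
      finally have n: "nrm x \<le> k * frob x" .
      have f: "frob x < \<rho> / k" "frob x \<le> \<epsilon> / ((K + 1) * k\<^sup>2)" using x(2) by (auto simp: \<delta>_def)
      have "k * frob x < \<rho>" using f(1) k by (simp add: field_simps)
      then have "\<bar>F x\<bar> \<le> K * (nrm x)\<^sup>2" using F[OF x(1)] R x(1) n by simp
      also have "\<dots> \<le> K * (k * frob x)\<^sup>2"
        using n nrm_nonneg[of x] K by (intro mult_left_mono power_mono) auto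
      also have "\<dots> \<le> (K + 1) * (k * frob x)\<^sup>2" by (intro mult_right_mono) auto
      also have "\<dots> = ((K + 1) * k\<^sup>2 * frob x) * frob x" by (simp add: power2_eq_square)
      also have "\<dots> \<le> \<epsilon> * frob x"
      proof (intro mult_right_mono frob_nonneg)
        have "(K + 1) * k\<^sup>2 > 0" using K k by simp
        then show "(K + 1) * k\<^sup>2 * frob x \<le> \<epsilon>" using f(2) by (simp only: pos_le_divide_eq mult.commute)
      qed
      finally show ?thesis .
    qed
    with \<delta> show "\<exists>\<delta>>0. \<forall>x\<in>S. frob x < \<delta> \<longrightarrow> \<bar>F x\<bar> \<le> \<epsilon> * frob x" by blast
  qed
qed

text \<open>Common to the directions of R and of b. \<open>S\<close> is the set of directions x, and
  \<open>dA x\<close>, \<open>dB x\<close>, \<open>dC x\<close> are the resulting increments of the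
  closed-loop matrices. They may contain terms of second order in x, so they are bounded only for
  \<open>nrm x \<le> 1\<close> and \<open>l\<close> matches the pairing only up to a quadratic
  error. \<open>F\<close> has to be identified only under unique solvability, which the expansion
  supplies.\<close>

theorem lyapunov_cost_critical_iff:
  assumes hw: "hurwitz A" and A: "A \<in> carrier_mat N N" and B: "B \<in> carrier_mat N m" and C: "C \<in> carrier_mat q N"
    and P: "P \<in> carrier_mat N N" "A * P + P * A\<^sup>T + B * B\<^sup>T = 0\<^sub>m N N"
    and Q: "Q \<in> carrier_mat N N" "A\<^sup>T * Q + Q * A + C\<^sup>T * C = 0\<^sub>m N N"
    and S: "S \<subseteq> carrier_mat r c" and cone: "\<And>t x. x \<in> S \<Longrightarrow> t \<cdot>\<^sub>m x \<in> S"
    and d: "\<And>x. x \<in> S \<Longrightarrow> dA x \<in> carrier_mat N N" "\<And>x. x \<in> S \<Longrightarrow> dB x \<in> carrier_mat N m"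
      "\<And>x. x \<in> S \<Longrightarrow> dC x \<in> carrier_mat q N"
    and k: "k > 0"
    and bd: "\<And>x. x \<in> S \<Longrightarrow> nrm x \<le> 1 \<Longrightarrow> nrm (dA x) \<le> k * nrm x"
      "\<And>x. x \<in> S \<Longrightarrow> nrm x \<le> 1 \<Longrightarrow> nrm (dB x) \<le> k * nrm x"
      "\<And>x. x \<in> S \<Longrightarrow> nrm x \<le> 1 \<Longrightarrow> nrm (dC x) \<le> k * nrm x"
    and lin: "\<And>x. x \<in> S \<Longrightarrow>
      \<bar>ip (Q * P) (dA x) + ip (Q * B) (dB x) + ip (C * P) (dC x) - l x\<bar> \<le> k * (nrm x)\<^sup>2"
    and l: "\<And>t x. x \<in> S \<Longrightarrow> l (t \<cdot>\<^sub>m x) = t * l x"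
    and F: "\<And>x P'. x \<in> S \<Longrightarrow> P' \<in> carrier_mat N N \<Longrightarrow>
      (A + dA x) * P' + P' * (A + dA x)\<^sup>T + (B + dB x) * (B + dB x)\<^sup>T = 0\<^sub>m N N \<Longrightarrow>
      \<exists>!P'. P' \<in> carrier_mat N N \<and>
        (A + dA x) * P' + P' * (A + dA x)\<^sup>T + (B + dB x) * (B + dB x)\<^sup>T = 0\<^sub>m N N \<Longrightarrow>
      F x = ip ((C + dC x)\<^sup>T * (C + dC x)) P' - ip (C\<^sup>T * C) P"
  shows "(\<forall>\<epsilon>>0. \<exists>\<delta>>0. \<forall>x\<in>S. frob x < \<delta> \<longrightarrow> \<bar>F x\<bar> \<le> \<epsilon> * frob x) \<longleftrightarrow> (\<forall>x\<in>S. l x = 0)"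
proof -
  from lyapunov_cost_expansion[OF hw A B C P Q] obtain \<delta> K where \<delta>: "\<delta> > 0" and K: "K \<ge> 0"
    and exp: "\<forall>dA \<in> carrier_mat N N. \<forall>dB \<in> carrier_mat N m. \<forall>dC \<in> carrier_mat q N. \<forall>d<\<delta>.
     nrm dA \<le> d \<and> nrm dB \<le> d \<and> nrm dC \<le> d \<longrightarrow>
     (\<exists>!P'. P' \<in> carrier_mat N N \<and>
        (A + dA) * P' + P' * (A + dA)\<^sup>T + (B + dB) * (B + dB)\<^sup>T = 0\<^sub>m N N) \<and>
     (\<forall>P' \<in> carrier_mat N N.
        (A + dA) * P' + P' * (A + dA)\<^sup>T + (B + dB) * (B + dB)\<^sup>T = 0\<^sub>m N N \<longrightarrow>
        \<bar>ip ((C + dC)\<^sup>T * (C + dC)) P' - ip (C\<^sup>T * C) P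
          - 2 * (ip (Q * P) dA + ip (Q * B) dB + ip (C * P) dC)\<bar> \<le> K * d\<^sup>2)"
    by (elim exE conjE) (rule that)
  have est: "\<bar>F x - 2 * l x\<bar> \<le> (K * k\<^sup>2 + 2 * k) * (nrm x)\<^sup>2"
    if x: "x \<in> S" and nx: "nrm x < min 1 (\<delta> / k)" for x
  proof -
    have "k * nrm x < \<delta>" using nx k by (simp add: field_simps)
    moreover have "nrm (dA x) \<le> k * nrm x \<and> nrm (dB x) \<le> k * nrm x \<and> nrm (dC x) \<le> k * nrm x"
      using bd[OF x] nx by auto
    ultimately have e: "(\<exists>!P'. P' \<in> carrier_mat N N \<and>
        (A + dA x) * P' + P' * (A + dA x)\<^sup>T + (B + dB x) * (B + dB x)\<^sup>T = 0\<^sub>m N N) \<and>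
     (\<forall>P' \<in> carrier_mat N N.
        (A + dA x) * P' + P' * (A + dA x)\<^sup>T + (B + dB x) * (B + dB x)\<^sup>T = 0\<^sub>m N N \<longrightarrow>
        \<bar>ip ((C + dC x)\<^sup>T * (C + dC x)) P' - ip (C\<^sup>T * C) P
          - 2 * (ip (Q * P) (dA x) + ip (Q * B) (dB x) + ip (C * P) (dC x))\<bar> \<le> K * (k * nrm x)\<^sup>2)"
      using exp d[OF x] by simp
    from conjunct1[OF e] obtain P' where P': "P' \<in> carrier_mat N N"
      "(A + dA x) * P' + P' * (A + dA x)\<^sup>T + (B + dB x) * (B + dB x)\<^sup>T = 0\<^sub>m N N"
      by (elim ex1E conjE) (rule that)
    note F[OF x P' conjunct1[OF e]]
    moreover note conjunct2[OF e, rule_format, OF P']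
    moreover have "(K * k\<^sup>2 + 2 * k) * (nrm x)\<^sup>2 = K * (k * nrm x)\<^sup>2 + 2 * (k * (nrm x)\<^sup>2)"
      by (simp add: power2_eq_square algebra_simps)
    moreover have "\<bar>f - 2 * s\<bar> \<le> a \<Longrightarrow> \<bar>s - t\<bar> \<le> b \<Longrightarrow> \<bar>f - 2 * t\<bar> \<le> a + 2 * b" for f s t a b :: real
      by (auto simp: abs_le_iff)
    ultimately show ?thesis using lin[OF x] by simp
  qed
  \<comment> \<open>The derivative is twice the pairing, hence \<open>2 * l x\<close>; the factor is
    dropped afterwards.\<close>
  have "(\<forall>\<epsilon>>0. \<exists>\<delta>>0. \<forall>x\<in>S. frob x < \<delta> \<longrightarrow> \<bar>F x\<bar> \<le> \<epsilon> * frob x) \<longleftrightarrow> (\<forall>x\<in>S. 2 * l x = 0)"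
    using \<delta> k K est l
    by (intro first_order_criterion[OF S cone, where \<rho> = "min 1 (\<delta> / k)" and K = "K * k\<^sup>2 + 2 * k"]) auto
  then show ?thesis by simp
qed

subsection \<open>Block matrices\<close>

lemma sum_lessThan_add: "(\<Sum>i<a + b. f i) = (\<Sum>i<a. f i) + (\<Sum>i<b. f (a + i))"
  for f :: "nat \<Rightarrow> real" and a b :: nat
  by (induction b) (simp_all add: add.assoc)

lemma vcat_dims [simp]: "dim_row (vcat X Y) = dim_row X + dim_row Y" "dim_col (vcat X Y) = dim_col X"
  by (simp_all add: vcat_def)

lemma hcat_dims [simp]: "dim_row (hcat X Y) = dim_row X" "dim_col (hcat X Y) = dim_col X + dim_col Y"
  by (simp_all add: hcat_def)

lemma blk_dims [simp]: "dim_row (blk X n j k) = n" "dim_col (blk X n j k) = n"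
  by (simp_all add: blk_def)

lemma vcat_index:
  "i < dim_row X \<Longrightarrow> j < dim_col X \<Longrightarrow> vcat X Y $$ (i,j) = X $$ (i,j)"
  "i < dim_row Y \<Longrightarrow> j < dim_col X \<Longrightarrow> vcat X Y $$ (dim_row X + i, j) = Y $$ (i,j)"
  by (simp_all add: vcat_def)

lemma hcat_index:
  "i < dim_row X \<Longrightarrow> j < dim_col X \<Longrightarrow> hcat X Y $$ (i,j) = X $$ (i,j)"
  "i < dim_row X \<Longrightarrow> j < dim_col Y \<Longrightarrow> hcat X Y $$ (i, dim_col X + j) = Y $$ (i,j)"
  by (simp_all add: hcat_def)

lemma vcat_add:
  "dim_row X = dim_row X' \<Longrightarrow> dim_row Y = dim_row Y' \<Longrightarrow> dim_col X = dim_col X' \<Longrightarrow> dim_col Y = dim_col X' \<Longrightarrow>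
   dim_col Y' = dim_col X' \<Longrightarrow> vcat (X + X') (Y + Y') = vcat X Y + vcat X' Y'"
  by (rule eq_matI) (auto simp: vcat_def)

lemma hcat_add:
  "dim_row X = dim_row X' \<Longrightarrow> dim_row Y = dim_row X' \<Longrightarrow> dim_row Y' = dim_row X' \<Longrightarrow> dim_col X = dim_col X' \<Longrightarrow>
   dim_col Y = dim_col Y' \<Longrightarrow> hcat (X + X') (Y + Y') = hcat X Y + hcat X' Y'"
  by (rule eq_matI) (auto simp: hcat_def)

lemma nrm_vcat: "dim_col X = dim_col Y \<Longrightarrow> nrm (vcat X Y) = nrm X + nrm Y"
  by (simp add: nrm_def sum_lessThan_add vcat_index)

lemma nrm_hcat: "dim_row X = dim_row Y \<Longrightarrow> nrm (hcat X Y) = nrm X + nrm Y"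
  by (simp add: nrm_def sum_lessThan_add hcat_index sum.distrib)

lemma ip_blocks:
  assumes "X11 \<in> carrier_mat n n" "X12 \<in> carrier_mat n n" "X21 \<in> carrier_mat n n" "X22 \<in> carrier_mat n n"
    and H: "H \<in> carrier_mat (2 * n) (2 * n)"
  shows "ip H (vcat (hcat X11 X12) (hcat X21 X22)) =
    ip (blk H n 1 1) X11 + ip (blk H n 1 2) X12 + ip (blk H n 2 1) X21 + ip (blk H n 2 2) X22"
proof -
  have "vcat (hcat X11 X12) (hcat X21 X22) $$ (i,j) = X11 $$ (i,j)"
    "vcat (hcat X11 X12) (hcat X21 X22) $$ (i,n + j) = X12 $$ (i,j)"
    "vcat (hcat X11 X12) (hcat X21 X22) $$ (n + i,j) = X21 $$ (i,j)"
    "vcat (hcat X11 X12) (hcat X21 X22) $$ (n + i,n + j) = X22 $$ (i,j)" if "i < n" "j < n" for i j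
    using assms that by (simp_all add: vcat_def hcat_def)
  then show ?thesis
    using H by (simp add: ip_def mult_2 sum_lessThan_add blk_def sum.distrib)
qed

text \<open>Only the lower half of \<open>clB\<close> depends on b, so its increment has a zero
  upper block and only the second block row of \<open>Q\<close> contributes.\<close>

lemma ip_mult_vcat:
  assumes Q: "Q \<in> carrier_mat (2 * n) (2 * n)" and X: "X \<in> carrier_mat n k" "Y \<in> carrier_mat n k" "Z \<in> carrier_mat n k"
  shows "ip (Q * vcat X Y) (vcat (0\<^sub>m n k) Z) = ip (blk Q n 2 1 * X + blk Q n 2 2 * Y) Z"
proof -
  have "(Q * vcat X Y) $$ (n + i, j) = (blk Q n 2 1 * X + blk Q n 2 2 * Y) $$ (i,j)" if "i < n" "j < k" for i j
  proof -
    have "vcat X Y $$ (l,j) = X $$ (l,j)" "vcat X Y $$ (n + l,j) = Y $$ (l,j)" if "l < n" for l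
      using that \<open>j < k\<close> X by (auto simp: vcat_def)
    then show ?thesis
      using that Q X by (simp add: index_mult_sum sum_lessThan_add blk_def del: index_mult_mat(1))
  qed
  moreover have "vcat (0\<^sub>m n k) Z $$ (i,j) = 0" "vcat (0\<^sub>m n k) Z $$ (n + i,j) = Z $$ (i,j)" if "i < n" "j < k" for i j
    using that X by (auto simp: vcat_def)
  ultimately show ?thesis
    using Q X by (simp add: ip_def mult_2 sum_lessThan_add del: index_mult_mat(1) index_add_mat(1))
qed

text \<open>The counterpart for \<open>clC\<close>: only its right half depends on b, which selects
  the second block column of \<open>P\<close>.\<close>

lemma ip_hcat_mult:
  assumes P: "P \<in> carrier_mat (2 * n) (2 * n)" and X: "X \<in> carrier_mat k n" "Y \<in> carrier_mat k n" "Z \<in> carrier_mat k n"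
  shows "ip (hcat X Y * P) (hcat (0\<^sub>m k n) Z) = ip (X * blk P n 1 2 + Y * blk P n 2 2) Z"
proof -
  have "(hcat X Y * P) $$ (i, n + j) = (X * blk P n 1 2 + Y * blk P n 2 2) $$ (i,j)" if "i < k" "j < n" for i j
  proof -
    have "hcat X Y $$ (i,l) = X $$ (i,l)" "hcat X Y $$ (i,n + l) = Y $$ (i,l)" if "l < n" for l
      using that \<open>i < k\<close> X by (auto simp: hcat_def)
    then show ?thesis
      using that P X by (simp add: index_mult_sum mult_2 sum_lessThan_add blk_def del: index_mult_mat(1))
  qed
  moreover have "hcat (0\<^sub>m k n) Z $$ (i,j) = 0" "hcat (0\<^sub>m k n) Z $$ (i,n + j) = Z $$ (i,j)" if "i < k" "j < n" for i j
    using that X by (auto simp: hcat_def)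
  ultimately show ?thesis
    using P X by (simp add: ip_def mult_2 sum_lessThan_add del: index_mult_mat(1) index_add_mat(1))
qed

lemma blk_transpose:
  "X \<in> carrier_mat (2 * n) (2 * n) \<Longrightarrow> j \<in> {1,2} \<Longrightarrow> k \<in> {1,2} \<Longrightarrow> (blk X n j k)\<^sup>T = blk X\<^sup>T n k j"
  by (rule eq_matI) (auto simp: blk_def)

section \<open>Antisymmetric matrices and annihilators\<close>

lemma canonJ_dims [simp]: "dim_row (canonJ k) = k" "dim_col (canonJ k) = k"
  by (simp_all add: canonJ_def)

lemma canonJ_transpose: "(canonJ k)\<^sup>T = - canonJ k"
  by (rule eq_matI) (auto simp: canonJ_def)

lemma canonJ_square:
  assumes "even k"
  shows "canonJ k * canonJ k = - 1\<^sub>m k"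
proof (rule eq_matI)
  fix i j assume "i < dim_row (- 1\<^sub>m k :: real mat)" "j < dim_col (- 1\<^sub>m k :: real mat)"
  then have ij: "i < k" "j < k" by auto
  \<comment> \<open>Row i has a single nonzero entry, in the column of its partner index. Evenness
    of k keeps the partner of the last index in range.\<close>
  define i' where "i' = (if even i then i + 1 else i - 1)"
  have i': "i' < k" using ij assms by (auto simp: i'_def) (metis Suc_lessI even_Suc)
  have "(canonJ k * canonJ k) $$ (i,j) = (\<Sum>l<k. canonJ k $$ (i,l) * canonJ k $$ (l,j))"
    using ij by (subst index_mult_sum) auto
  also have "\<dots> = (\<Sum>l<k. if l = i' then canonJ k $$ (i,i') * canonJ k $$ (i',j) else 0)"
    using ij by (intro sum.cong refl) (auto simp: canonJ_def i'_def)
  also have "\<dots> = canonJ k $$ (i,i') * canonJ k $$ (i',j)"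
    using i' by simp
  also have "\<dots> = (- 1\<^sub>m k) $$ (i,j)"
    using ij i' by (auto simp: canonJ_def i'_def elim!: oddE)
  finally show "(canonJ k * canonJ k) $$ (i,j) = (- 1\<^sub>m k) $$ (i,j)" .
qed auto

lemma blockdiag_dims [simp]:
  "dim_row (blockdiag X Y) = dim_row X + dim_row Y" "dim_col (blockdiag X Y) = dim_col X + dim_col Y"
  by (simp_all add: blockdiag_def)

lemma blockdiag_antisymmetric:
  assumes "X \<in> carrier_mat k k" "Y \<in> carrier_mat l l" "X\<^sup>T = - X" "Y\<^sup>T = - Y"
  shows "(blockdiag X Y)\<^sup>T = - blockdiag X Y"
proof -
  have anti: "Z $$ (j,i) = - Z $$ (i,j)"
    if "Z \<in> carrier_mat d d" "Z\<^sup>T = - Z" "i < d" "j < d" for Z :: "real mat" and d i j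
    using arg_cong[OF that(2), of "\<lambda>M. M $$ (i,j)"] that(1,3,4) by simp
  show ?thesis
  proof (rule eq_matI)
    fix i j assume "i < dim_row (- blockdiag X Y)" "j < dim_col (- blockdiag X Y)"
    then have ij: "i < k + l" "j < k + l" using assms(1,2) by auto
    have X: "X $$ (j,i) = - X $$ (i,j)" if "i < k" "j < k"
      using anti[OF assms(1,3) that] .
    have Y: "Y $$ (j - k, i - k) = - Y $$ (i - k, j - k)" if "\<not> i < k" "\<not> j < k"
      using that ij by (intro anti[OF assms(2,4)]) auto
    show "(blockdiag X Y)\<^sup>T $$ (i,j) = (- blockdiag X Y) $$ (i,j)"
      using assms(1,2) ij X Y
      by (cases "i < k"; cases "j < k") (simp_all add: blockdiag_def vcat_def hcat_def)
  qed (use assms(1,2) in auto)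
qed

lemma ip_self_eq_0:
  assumes "ip X X = 0"
  shows "X = 0\<^sub>m (dim_row X) (dim_col X)"
proof -
  have "(frob X)\<^sup>2 = 0"
    using assms by (simp add: frob_def ip_def power2_eq_square sum_nonneg)
  then show ?thesis
    using nrm_le_frob[of X] nrm_nonneg[of X] by (intro nrm_eq_0D) simp
qed

text \<open>Testing with X = M + M^T works because M and M^T have the same pairing with a symmetric
  X, so X pairs to zero with itself. Conversely, transposing both arguments changes the sign of the
  pairing but not its value.\<close>

lemma symmetric_annihilator:
  assumes M: "M \<in> carrier_mat n n"
  shows "(\<forall>X \<in> {X \<in> carrier_mat n n. X\<^sup>T = X}. ip M X = 0) \<longleftrightarrow> M\<^sup>T = - M"
proof
  assume *: "\<forall>X \<in> {X \<in> carrier_mat n n. X\<^sup>T = X}. ip M X = 0"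
  let ?X = "M + M\<^sup>T"
  have X: "?X \<in> carrier_mat n n" "?X\<^sup>T = ?X"
    using M by (auto simp: transpose_add_dim comm_add_mat[of M n n])
  have "ip M ?X = 0" using * X by blast
  moreover have "ip M\<^sup>T ?X = 0"
    using \<open>ip M ?X = 0\<close> ip_transpose[of M ?X] M X by simp
  ultimately have "ip ?X ?X = 0" using M by (simp add: ip_add_left)
  then have Z: "?X = 0\<^sub>m n n" using ip_self_eq_0[of ?X] M by simp
  show "M\<^sup>T = - M"
  proof (rule eq_matI)
    fix i j assume ij: "i < dim_row (- M)" "j < dim_col (- M)"
    have "?X $$ (i,j) = 0" unfolding Z using ij M by simp
    then show "M\<^sup>T $$ (i,j) = (- M) $$ (i,j)" using ij M by simp
  qed (use M in auto)
next
  assume *: "M\<^sup>T = - M"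
  have "ip M X = 0" if "X \<in> carrier_mat n n" "X\<^sup>T = X" for X
    using ip_transpose[of M X] that M by (simp add: * ip_uminus_left)
  then show "\<forall>X \<in> {X \<in> carrier_mat n n. X\<^sup>T = X}. ip M X = 0" by blast
qed

text \<open>Both \<open>ctrl_a\<close> and \<open>ctrl_c\<close> contain the transpose of b between
  other factors. A final transposition of the pairing frees x, which is why M^T appears.\<close>

lemma ip_mult_transpose_mult:
  assumes "M \<in> carrier_mat r n" "K \<in> carrier_mat r s" "x \<in> carrier_mat n s" "J \<in> carrier_mat n n"
  shows "ip M (K * x\<^sup>T * J) = ip (J * M\<^sup>T * K) x"
proof -
  have "ip M (K * x\<^sup>T * J) = ip (M * J\<^sup>T) (K * x\<^sup>T)"
    using assms by (subst ip_mult_right') simp_all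
  also have "\<dots> = ip (K\<^sup>T * (M * J\<^sup>T)) x\<^sup>T"
    using assms by (subst ip_mult_right) simp_all
  also have "\<dots> = ip (K\<^sup>T * (M * J\<^sup>T))\<^sup>T x"
    using assms by (subst ip_transpose[symmetric]) simp_all
  also have "(K\<^sup>T * (M * J\<^sup>T))\<^sup>T = J * M\<^sup>T * K"
    using assms by (simp add: transpose_mult_dim mult_assoc_dim)
  finally show ?thesis .
qed

subsection \<open>Gradients of the closed-loop cost\<close>

locale plant_dims =
  fixes G :: plant and n m1 m2 p p0 :: nat
  assumes n_even: "even n"
    and plant_carrier [simp]: "pA G \<in> carrier_mat n n" "pB1 G \<in> carrier_mat n m1" "pB2 G \<in> carrier_mat n m2"
      "pC G \<in> carrier_mat p n" "pD G \<in> carrier_mat p m1"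
      "pC0 G \<in> carrier_mat p0 n" "pD0 G \<in> carrier_mat p0 m2"
begin

lemmas plant_dim [simp] = plant_carrier[THEN carrier_matD(1)] plant_carrier[THEN carrier_matD(2)]

lemma J_dim [simp]:
  "dim_row (J0 G) = n" "dim_col (J0 G) = n" "dim_row (J1 G) = m1" "dim_col (J1 G) = m1"
  "dim_row (J2 G) = m2" "dim_col (J2 G) = m2"
  by (simp_all add: J0_def J1_def J2_def)

lemma J_transpose: "(J0 G)\<^sup>T = - J0 G" "(J1 G)\<^sup>T = - J1 G" "(J2 G)\<^sup>T = - J2 G"
  by (simp_all add: J0_def J1_def J2_def canonJ_transpose)

lemma J0_square: "J0 G * J0 G = - 1\<^sub>m n"
  using n_even by (simp add: J0_def canonJ_square)

lemma derived_dim [simp]: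
  "dim_row (bigJ G) = m2 + p" "dim_col (bigJ G) = m2 + p" "dim_row (bfI G) = m2 + p" "dim_col (bfI G) = m2"
  "dim_row (bfC G) = m2 + p" "dim_col (bfC G) = n" "dim_row (bfD G) = m2 + p" "dim_col (bfD G) = m1 + m2"
  "dim_row (Bcat G) = n" "dim_col (Bcat G) = m1 + m2"
  by (simp_all add: bigJ_def bfI_def bfC_def bfD_def Bcat_def)

lemma bigJ_transpose: "(bigJ G)\<^sup>T = - bigJ G"
  unfolding bigJ_def
  by (rule blockdiag_antisymmetric[of _ m2 _ p])
    (auto simp: J_transpose transpose_mult_dim mult_assoc_dim)

lemma closed_loop_dim [simp]:
  "dim_row (ctrl_c G b) = m2" "dim_col (ctrl_c G b) = n" "dim_row (ctrl_a G R b) = dim_row b" "dim_col (ctrl_a G R b) = n"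
  "dim_row (clA G R b) = n + dim_row b" "dim_col (clA G R b) = n + n"
  "dim_row (clB G b) = n + dim_row b" "dim_col (clB G b) = m1 + m2"
  "dim_row (clC G b) = p0" "dim_col (clC G b) = n + n"
  by (simp_all add: ctrl_c_def ctrl_a_def clA_def clB_def clC_def)

lemma closed_loop_carrier:
  assumes "b \<in> carrier_mat n (m2 + p)"
  shows "clA G R b \<in> carrier_mat (2 * n) (2 * n)" "clB G b \<in> carrier_mat (2 * n) (m1 + m2)"
    "clC G b \<in> carrier_mat p0 (2 * n)"
  using assms by (auto intro!: carrier_matI)

lemma gramP_solution:
  assumes b: "b \<in> carrier_mat n (m2 + p)" and hw: "hurwitz (clA G R b)"
  defines "P \<equiv> gramP G R b"
  shows "P \<in> carrier_mat (2 * n) (2 * n)"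
    "clA G R b * P + P * (clA G R b)\<^sup>T + clB G b * (clB G b)\<^sup>T = 0\<^sub>m (2 * n) (2 * n)"
    "P\<^sup>T = P"
proof -
  note A = closed_loop_carrier(1)[OF b]
  have W: "clB G b * (clB G b)\<^sup>T \<in> carrier_mat (2 * n) (2 * n)"
    "(clB G b * (clB G b)\<^sup>T)\<^sup>T = clB G b * (clB G b)\<^sup>T"
    using closed_loop_carrier(2)[OF b] by (simp_all add: transpose_mult_dim)
  have "P \<in> carrier_mat (2 * n) (2 * n) \<and>
    clA G R b * P + P * (clA G R b)\<^sup>T + clB G b * (clB G b)\<^sup>T = 0\<^sub>m (2 * n) (2 * n)"
    using theI'[OF lyapunov_unique_solution[OF A W(1) lyapunov_injective[OF hw A]]]
    by (simp add: P_def gramP_def)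
  then show P: "P \<in> carrier_mat (2 * n) (2 * n)"
    "clA G R b * P + P * (clA G R b)\<^sup>T + clB G b * (clB G b)\<^sup>T = 0\<^sub>m (2 * n) (2 * n)" by auto
  show "P\<^sup>T = P"
    by (rule lyapunov_solution_symmetric[OF A W lyapunov_injective[OF hw A] P])
qed

lemma gramQ_solution:
  assumes b: "b \<in> carrier_mat n (m2 + p)" and hw: "hurwitz (clA G R b)"
  defines "Q \<equiv> gramQ G R b"
  shows "Q \<in> carrier_mat (2 * n) (2 * n)"
    "(clA G R b)\<^sup>T * Q + Q * clA G R b + (clC G b)\<^sup>T * clC G b = 0\<^sub>m (2 * n) (2 * n)"
proof -
  have A: "(clA G R b)\<^sup>T \<in> carrier_mat (2 * n) (2 * n)"
    using closed_loop_carrier(1)[OF b] by simp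
  have W: "(clC G b)\<^sup>T * clC G b \<in> carrier_mat (2 * n) (2 * n)"
    using closed_loop_carrier(3)[OF b] by simp
  have "Q \<in> carrier_mat (2 * n) (2 * n) \<and>
    (clA G R b)\<^sup>T * Q + Q * clA G R b + (clC G b)\<^sup>T * clC G b = 0\<^sub>m (2 * n) (2 * n)"
    using theI'[OF lyapunov_unique_solution[OF A W lyapunov_injective[OF hurwitz_transpose[OF hw] A]]]
    by (simp add: Q_def gramQ_def)
  then show "Q \<in> carrier_mat (2 * n) (2 * n)"
    "(clA G R b)\<^sup>T * Q + Q * clA G R b + (clC G b)\<^sup>T * clC G b = 0\<^sub>m (2 * n) (2 * n)" by auto
qed

text \<open>Unique solvability is a premise so that the lemma also applies to perturbed pairs, where
  stability is not known.\<close>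

lemma costE_eq:
  assumes b: "b \<in> carrier_mat n (m2 + p)"
    and P: "P \<in> carrier_mat (2 * n) (2 * n)"
      "clA G R b * P + P * (clA G R b)\<^sup>T + clB G b * (clB G b)\<^sup>T = 0\<^sub>m (2 * n) (2 * n)"
    and ex1: "\<exists>!P. P \<in> carrier_mat (2 * n) (2 * n) \<and>
      clA G R b * P + P * (clA G R b)\<^sup>T + clB G b * (clB G b)\<^sup>T = 0\<^sub>m (2 * n) (2 * n)"
  shows "costE G R b = ip ((clC G b)\<^sup>T * clC G b) P"
proof -
  have "gramP G R b = P"
    using the1_equality[OF ex1, of P] P by (simp add: gramP_def)
  then show ?thesis
    using P(1) by (simp add: costE_def mtrace_congruence del: assoc_mult_mat)
qed

section \<open>Increments of the closed-loop matrices\<close>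

lemma ctrl_c_add:
  assumes "b \<in> carrier_mat n (m2 + p)" "x \<in> carrier_mat n (m2 + p)"
  shows "ctrl_c G (b + x) = ctrl_c G b + ctrl_c G x"
  using assms by (simp add: ctrl_c_def transpose_add_dim mult_add_dim add_mult_dim)

text \<open>\<open>aL\<close> and \<open>aQ\<close> are the parts of \<open>a (b + x) - a b\<close> linear and quadratic in \<open>x\<close>.\<close>

definition aL :: "real mat \<Rightarrow> real mat \<Rightarrow> real mat" where
  "aL b x = (1/2) \<cdot>\<^sub>m (x * bigJ G * b\<^sup>T * J0 G + b * bigJ G * x\<^sup>T * J0 G)"

definition aQ :: "real mat \<Rightarrow> real mat" where
  "aQ x = (1/2) \<cdot>\<^sub>m (x * bigJ G * x\<^sup>T * J0 G)"

lemma aL_aQ_dim [simp]: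
  "dim_row (aL b x) = dim_row b" "dim_col (aL b x) = n" "dim_row (aQ x) = dim_row x" "dim_col (aQ x) = n"
  by (simp_all add: aL_def aQ_def)

lemma ctrl_a_add:
  assumes "b \<in> carrier_mat n (m2 + p)" "x \<in> carrier_mat n (m2 + p)" "R \<in> carrier_mat n n"
  shows "ctrl_a G R (b + x) = ctrl_a G R b + (aL b x + aQ x)"
  using assms by (intro eq_matI)
    (simp_all add: ctrl_a_def aL_def aQ_def transpose_add_dim mult_add_dim add_mult_dim field_simps
      del: index_mult_mat(1) assoc_mult_mat)

lemma clA_add_b:
  assumes "b \<in> carrier_mat n (m2 + p)" "x \<in> carrier_mat n (m2 + p)" "R \<in> carrier_mat n n"
  shows "clA G R (b + x) = clA G R b +
    vcat (hcat (0\<^sub>m n n) (pB2 G * ctrl_c G x)) (hcat (x * bfC G) (aL b x + aQ x))"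
proof -
  note [simp] = assms assms[THEN carrier_matD(1)] assms[THEN carrier_matD(2)]
  \<comment> \<open>The unchanged block is written as a sum with zero so that block additivity
    applies to all four blocks at once; hence the deletion of the simp rule for adding zero
    below.\<close>
  have "clA G R (b + x) = vcat (hcat (pA G + 0\<^sub>m n n) (pB2 G * ctrl_c G b + pB2 G * ctrl_c G x))
      (hcat (b * bfC G + x * bfC G) (ctrl_a G R b + (aL b x + aQ x)))"
    by (simp add: clA_def ctrl_c_add ctrl_a_add mult_add_dim add_mult_dim add_zero_dim)
  then show ?thesis
    by (simp add: vcat_add hcat_add clA_def del: right_add_zero_mat)
qed

lemma clB_add:
  assumes "b \<in> carrier_mat n (m2 + p)" "x \<in> carrier_mat n (m2 + p)"
  shows "clB G (b + x) = clB G b + vcat (0\<^sub>m n (m1 + m2)) (x * bfD G)"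
proof -
  note [simp] = assms assms[THEN carrier_matD(1)] assms[THEN carrier_matD(2)]
  have "clB G (b + x) = vcat (Bcat G + 0\<^sub>m n (m1 + m2)) (b * bfD G + x * bfD G)"
    by (simp add: clB_def add_mult_dim add_zero_dim)
  then show ?thesis by (simp add: clB_def vcat_add del: right_add_zero_mat)
qed

lemma clC_add:
  assumes "b \<in> carrier_mat n (m2 + p)" "x \<in> carrier_mat n (m2 + p)"
  shows "clC G (b + x) = clC G b + hcat (0\<^sub>m p0 n) (pD0 G * ctrl_c G x)"
proof -
  note [simp] = assms assms[THEN carrier_matD(1)] assms[THEN carrier_matD(2)]
  have "clC G (b + x) = hcat (pC0 G + 0\<^sub>m p0 n) (pD0 G * ctrl_c G b + pD0 G * ctrl_c G x)"
    by (simp add: clC_def ctrl_c_add mult_add_dim add_zero_dim)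
  then show ?thesis by (simp add: clC_def hcat_add del: right_add_zero_mat)
qed

lemma clA_add_R:
  assumes "b \<in> carrier_mat n (m2 + p)" "R \<in> carrier_mat n n" "x \<in> carrier_mat n n"
  shows "clA G (R + x) b = clA G R b +
    vcat (hcat (0\<^sub>m n n) (0\<^sub>m n n)) (hcat (0\<^sub>m n n) (J0 G * x))"
proof -
  note [simp] = assms assms[THEN carrier_matD(1)] assms[THEN carrier_matD(2)]
  have "ctrl_a G (R + x) b = ctrl_a G R b + J0 G * x"
    by (rule eq_matI) (simp_all add: ctrl_a_def mult_add_dim del: index_mult_mat(1) assoc_mult_mat)
  then have "clA G (R + x) b = vcat (hcat (pA G + 0\<^sub>m n n) (pB2 G * ctrl_c G b + 0\<^sub>m n n))
      (hcat (b * bfC G + 0\<^sub>m n n) (ctrl_a G R b + J0 G * x))"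
    by (simp add: clA_def add_zero_dim)
  then show ?thesis
    by (simp add: vcat_add hcat_add clA_def del: right_add_zero_mat)
qed

section \<open>Size of the increments in b\<close>

lemma nrm_ctrl_c:
  assumes "x \<in> carrier_mat n (m2 + p)"
  shows "nrm (ctrl_c G x) \<le> nrm (J2 G * (bfI G)\<^sup>T) * nrm (J0 G) * nrm x"
proof -
  note [simp] = assms assms[THEN carrier_matD(1)] assms[THEN carrier_matD(2)]
  have "nrm (ctrl_c G x) \<le> nrm (J2 G * (bfI G)\<^sup>T * x\<^sup>T) * nrm (J0 G)"
    unfolding ctrl_c_def by (rule nrm_mult) simp
  also have "\<dots> \<le> nrm (J2 G * (bfI G)\<^sup>T) * nrm x\<^sup>T * nrm (J0 G)"
    by (intro mult_right_mono nrm_mult nrm_nonneg) simp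
  finally show ?thesis by (simp add: nrm_transpose mult_ac)
qed

lemma nrm_quadruple:
  assumes "x \<in> carrier_mat n (m2 + p)" "y \<in> carrier_mat n (m2 + p)"
  shows "nrm (x * bigJ G * y\<^sup>T * J0 G) \<le> nrm (bigJ G) * nrm (J0 G) * nrm x * nrm y"
proof -
  note [simp] = assms assms[THEN carrier_matD(1)] assms[THEN carrier_matD(2)]
  have "nrm (x * bigJ G * y\<^sup>T * J0 G) \<le> nrm (x * bigJ G * y\<^sup>T) * nrm (J0 G)"
    by (rule nrm_mult) simp
  also have "\<dots> \<le> nrm (x * bigJ G) * nrm y\<^sup>T * nrm (J0 G)"
    by (intro mult_right_mono nrm_mult nrm_nonneg) simp
  also have "\<dots> \<le> nrm x * nrm (bigJ G) * nrm y\<^sup>T * nrm (J0 G)"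
    by (intro mult_right_mono nrm_mult nrm_nonneg) simp
  finally show ?thesis by (simp add: nrm_transpose mult_ac)
qed

lemma nrm_aL:
  assumes "b \<in> carrier_mat n (m2 + p)" "x \<in> carrier_mat n (m2 + p)"
  shows "nrm (aL b x) \<le> nrm (bigJ G) * nrm (J0 G) * nrm b * nrm x"
proof -
  note [simp] = assms assms[THEN carrier_matD(1)] assms[THEN carrier_matD(2)]
  have "nrm (aL b x) \<le> (1/2) * (nrm (x * bigJ G * b\<^sup>T * J0 G) + nrm (b * bigJ G * x\<^sup>T * J0 G))"
    using nrm_add[of "x * bigJ G * b\<^sup>T * J0 G" "b * bigJ G * x\<^sup>T * J0 G"] by (simp add: aL_def nrm_smult)
  then show ?thesis
    using nrm_quadruple[OF assms] nrm_quadruple[OF assms(2,1)] by (simp add: mult_ac)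
qed

lemma nrm_aQ:
  assumes "x \<in> carrier_mat n (m2 + p)"
  shows "nrm (aQ x) \<le> nrm (bigJ G) * nrm (J0 G) * (nrm x)\<^sup>2"
  using assms nrm_quadruple[OF assms assms] nrm_nonneg[of "x * bigJ G * x\<^sup>T * J0 G"]
  by (simp add: aQ_def nrm_smult power2_eq_square mult_ac)

text \<open>With \<open>\<Phi> = (H\<^sub>2\<^sub>2 J\<^sub>0 + J\<^sub>0 H\<^sub>2\<^sub>2\<^sup>T) / 2\<close> this is half the gradient in \<open>b\<close>.\<close>

definition gradb :: "real mat \<Rightarrow> real mat \<Rightarrow> real mat \<Rightarrow> real mat" where
  "gradb R b \<Phi> = (let H = gramQ G R b * gramP G R b; P = gramP G R b; Q = gramQ G R b in
     opM G R b \<Phi> b + blk H n 2 1 * (bfC G)\<^sup>T + blk Q n 2 1 * Bcat G * (bfD G)\<^sup>T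
     + J0 G * ((blk H n 1 2)\<^sup>T * pB2 G + blk P n 2 1 * (pC0 G)\<^sup>T * pD0 G) * J2 G * (bfI G)\<^sup>T)"

lemma gradb_dim [simp]: "dim_row (gradb R b \<Phi>) = n" "dim_col (gradb R b \<Phi>) = m2 + p"
  by (simp_all add: gradb_def Let_def)

section \<open>The first-order change in b as a pairing with the increment\<close>

lemma ip_mult_ctrl_c:
  assumes "M \<in> carrier_mat r n" "K \<in> carrier_mat r m2" "x \<in> carrier_mat n (m2 + p)"
  shows "ip M (K * ctrl_c G x) = ip (J0 G * M\<^sup>T * (K * (J2 G * (bfI G)\<^sup>T))) x"
proof -
  have "K * ctrl_c G x = K * (J2 G * (bfI G)\<^sup>T) * x\<^sup>T * J0 G"
    using assms by (simp add: ctrl_c_def mult_assoc_dim)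
  then show ?thesis
    using assms by (simp only:) (rule ip_mult_transpose_mult[of _ r n _ "m2 + p"]; auto intro!: carrier_matI)
qed

text \<open>Varying the left factor b contributes M J0 b J, where the signs from transposing the
  antisymmetric J0 and J cancel; varying b^T contributes J0 M^T b J. Their half sum is the
  symmetrisation that defines Phi.\<close>

lemma ip_aL:
  assumes "M \<in> carrier_mat n n" "b \<in> carrier_mat n (m2 + p)" "x \<in> carrier_mat n (m2 + p)"
  shows "ip M (aL b x) = ip ((1/2) \<cdot>\<^sub>m (M * J0 G + J0 G * M\<^sup>T) * b * bigJ G) x"
proof -
  have "ip M (x * bigJ G * b\<^sup>T * J0 G) = ip M (x * (bigJ G * b\<^sup>T * J0 G))"
    using assms by (simp add: mult_assoc_dim)
  also have "\<dots> = ip (M * (bigJ G * b\<^sup>T * J0 G)\<^sup>T) x"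
    using assms by (subst ip_mult_right') simp_all
  also have "(bigJ G * b\<^sup>T * J0 G)\<^sup>T = J0 G * b * bigJ G"
    using assms by (simp add: transpose_mult_dim J_transpose bigJ_transpose mult_assoc_dim)
  finally have 1: "ip M (x * bigJ G * b\<^sup>T * J0 G) = ip (M * J0 G * b * bigJ G) x"
    using assms by (simp add: mult_assoc_dim)
  have 2: "ip M (b * bigJ G * x\<^sup>T * J0 G) = ip (J0 G * M\<^sup>T * b * bigJ G) x"
  proof -
    have "b * bigJ G \<in> carrier_mat n (m2 + p)" "J0 G \<in> carrier_mat n n"
      using assms by (auto intro!: carrier_matI)
    from ip_mult_transpose_mult[OF assms(1) this(1) assms(3) this(2)] show ?thesis
      using assms by (simp add: mult_assoc_dim)
  qed
  have "ip M (aL b x) = (1/2) * (ip M (x * bigJ G * b\<^sup>T * J0 G) + ip M (b * bigJ G * x\<^sup>T * J0 G))"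
    using assms by (simp add: aL_def ip_smult_right ip_add_right del: assoc_mult_mat)
  also have "\<dots> = ip ((1/2) \<cdot>\<^sub>m (M * J0 G + J0 G * M\<^sup>T) * b * bigJ G) x"
    unfolding 1 2 using assms
    by (simp add: ip_smult_left ip_add_left smult_mult_dim add_mult_dim del: assoc_mult_mat)
  finally show ?thesis .
qed

lemma ctrl_c_transpose:
  "b \<in> carrier_mat n (m2 + p) \<Longrightarrow> (ctrl_c G b)\<^sup>T = J0 G * (b * (bfI G * J2 G))"
  by (simp add: ctrl_c_def transpose_mult_dim J_transpose mult_assoc_dim)

text \<open>The right side lists the first-order contributions of the blocks (1,2), (2,1), (2,2) of
  the increment of A, then those of B and C. In \<open>opM\<close> the term with
  \<open>bfD G\<close> stems from B and the term with \<open>pD0 G\<close> from C.\<close>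

lemma ip_gradb:
  assumes b: "b \<in> carrier_mat n (m2 + p)" and x: "x \<in> carrier_mat n (m2 + p)" and hw: "hurwitz (clA G R b)"
  defines "P \<equiv> gramP G R b" and "Q \<equiv> gramQ G R b"
  defines "H \<equiv> Q * P"
  shows "ip (gradb R b ((1/2) \<cdot>\<^sub>m (blk H n 2 2 * J0 G + J0 G * (blk H n 2 2)\<^sup>T))) x =
      ip (blk H n 1 2) (pB2 G * ctrl_c G x) + ip (blk H n 2 1) (x * bfC G) + ip (blk H n 2 2) (aL b x)
      + ip (blk Q n 2 1 * Bcat G + blk Q n 2 2 * (b * bfD G)) (x * bfD G)
      + ip (pC0 G * blk P n 1 2 + pD0 G * ctrl_c G b * blk P n 2 2) (pD0 G * ctrl_c G x)"
    (is "ip (gradb R b ?\<Phi>) x = _")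
proof -
  note Ps = gramP_solution[OF b hw, folded P_def]
  \<comment> \<open>Freeing x transposes the blocks of P; symmetry of P gives back the blocks named
    in the theorem.\<close>
  have Pt: "(blk P n 1 2)\<^sup>T = blk P n 2 1" "(blk P n 2 2)\<^sup>T = blk P n 2 2"
    using Ps by (simp_all add: blk_transpose)
  have 1: "ip (blk H n 1 2) (pB2 G * ctrl_c G x) = ip (J0 G * (blk H n 1 2)\<^sup>T * (pB2 G * (J2 G * (bfI G)\<^sup>T))) x"
    using x by (intro ip_mult_ctrl_c) (auto intro!: carrier_matI)
  have 2: "ip (blk H n 2 1) (x * bfC G) = ip (blk H n 2 1 * (bfC G)\<^sup>T) x"
    using x by (subst ip_mult_right') simp_all
  have 3: "ip (blk H n 2 2) (aL b x) = ip (?\<Phi> * b * bigJ G) x"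
    using x b by (intro ip_aL) (auto intro!: carrier_matI)
  have 4: "ip (blk Q n 2 1 * Bcat G + blk Q n 2 2 * (b * bfD G)) (x * bfD G)
      = ip (blk Q n 2 1 * Bcat G * (bfD G)\<^sup>T) x + ip (blk Q n 2 2 * b * bfD G * (bfD G)\<^sup>T) x"
    using x b by (subst ip_mult_right') (simp_all add: add_mult_dim ip_add_left mult_assoc_dim)
  let ?M = "pC0 G * blk P n 1 2 + pD0 G * ctrl_c G b * blk P n 2 2"
  have "ip ?M (pD0 G * ctrl_c G x) = ip (J0 G * ?M\<^sup>T * (pD0 G * (J2 G * (bfI G)\<^sup>T))) x"
    using x by (intro ip_mult_ctrl_c) (auto intro!: carrier_matI)
  also have "?M\<^sup>T = blk P n 2 1 * (pC0 G)\<^sup>T + blk P n 2 2 * (J0 G * (b * (bfI G * J2 G)) * (pD0 G)\<^sup>T)"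
    using b by (simp add: transpose_add_dim transpose_mult_dim Pt[unfolded One_nat_def] ctrl_c_transpose mult_assoc_dim)
  finally have 5: "ip ?M (pD0 G * ctrl_c G x) =
      ip (J0 G * (blk P n 2 1 * (pC0 G)\<^sup>T * pD0 G) * J2 G * (bfI G)\<^sup>T) x
      + ip (J0 G * blk P n 2 2 * J0 G * b * bfI G * J2 G * (pD0 G)\<^sup>T * pD0 G * J2 G * (bfI G)\<^sup>T) x"
    using b by (simp add: add_mult_dim mult_add_dim ip_add_left mult_assoc_dim)
  have 6: "ip (gradb R b ?\<Phi>) x = ip (?\<Phi> * b * bigJ G) x + ip (blk Q n 2 2 * b * bfD G * (bfD G)\<^sup>T) x
      + ip (J0 G * blk P n 2 2 * J0 G * b * bfI G * J2 G * (pD0 G)\<^sup>T * pD0 G * J2 G * (bfI G)\<^sup>T) x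
      + ip (blk H n 2 1 * (bfC G)\<^sup>T) x + ip (blk Q n 2 1 * Bcat G * (bfD G)\<^sup>T) x
      + (ip (J0 G * (blk H n 1 2)\<^sup>T * (pB2 G * (J2 G * (bfI G)\<^sup>T))) x
         + ip (J0 G * (blk P n 2 1 * (pC0 G)\<^sup>T * pD0 G) * J2 G * (bfI G)\<^sup>T) x)"
    using b by (simp add: gradb_def opM_def Let_def add_mult_dim mult_add_dim ip_add_left mult_assoc_dim
        flip: P_def Q_def H_def)
  show ?thesis unfolding 1 2 3 4 5 6 by simp
qed

section \<open>Vanishing of each derivative separately\<close>

lemma costE_eq_gramP:
  assumes b: "b \<in> carrier_mat n (m2 + p)" and hw: "hurwitz (clA G R b)"
  shows "costE G R b = ip ((clC G b)\<^sup>T * clC G b) (gramP G R b)"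
proof (rule costE_eq[OF b gramP_solution(1,2)[OF b hw]])
  note A = closed_loop_carrier(1)[OF b]
  have "clB G b * (clB G b)\<^sup>T \<in> carrier_mat (2 * n) (2 * n)"
    using closed_loop_carrier(2)[OF b] by simp
  from lyapunov_unique_solution[OF A this lyapunov_injective[OF hw A]]
  show "\<exists>!P. P \<in> carrier_mat (2 * n) (2 * n) \<and>
      clA G R b * P + P * (clA G R b)\<^sup>T + clB G b * (clB G b)\<^sup>T = 0\<^sub>m (2 * n) (2 * n)" .
qed

lemma dE_R_zero_iff:
  assumes b: "b \<in> carrier_mat n (m2 + p)" and R: "R \<in> carrier_mat n n" and hw: "hurwitz (clA G R b)"
  defines "H22 \<equiv> blk (gramQ G R b * gramP G R b) n 2 2"
  shows "dE_R_zero G R b \<longleftrightarrow> (H22 * J0 G)\<^sup>T = - (H22 * J0 G)"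
proof -
  note P = gramP_solution[OF b hw] and Q = gramQ_solution[OF b hw] and c = closed_loop_carrier[OF b]
  let ?S = "{x \<in> carrier_mat n n. x\<^sup>T = x}"
  let ?F = "\<lambda>x. costE G (R + x) b - costE G R b"
  \<comment> \<open>R enters only through the summand \<open>J0 G * R\<close> of
    \<open>ctrl_a\<close>: one block of A moves, and B and C stay fixed.\<close>
  define dA where "dA x = vcat (hcat (0\<^sub>m n n) (0\<^sub>m n n)) (hcat (0\<^sub>m n n) (J0 G * x))" for x
  let ?dB = "\<lambda>x::real mat. 0\<^sub>m (2 * n) (m1 + m2) :: real mat" and ?dC = "\<lambda>x::real mat. 0\<^sub>m p0 (2 * n) :: real mat"
  have H22: "H22 \<in> carrier_mat n n" by (auto simp: H22_def intro!: carrier_matI)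
  have "dE_R_zero G R b \<longleftrightarrow> (\<forall>\<epsilon>>0. \<exists>\<delta>>0. \<forall>x\<in>?S. frob x < \<delta> \<longrightarrow> \<bar>?F x\<bar> \<le> \<epsilon> * frob x)"
    by (simp add: dE_R_zero_def Ball_def imp_conjL)
  also have "\<dots> \<longleftrightarrow> (\<forall>x\<in>?S. ip ((J0 G)\<^sup>T * H22) x = 0)"
  proof (rule lyapunov_cost_critical_iff[OF hw c P(1,2) Q, where r = n and c = n and dA = dA and dB = ?dB and dC = ?dC
        and k = "nrm (J0 G) + 1"])
    fix x :: "real mat" assume "x \<in> ?S"
    then have x: "x \<in> carrier_mat n n" and xs: "x\<^sup>T = x" by auto
    show "dA x \<in> carrier_mat (2 * n) (2 * n)" using x by (auto simp: dA_def intro!: carrier_matI)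
    have "nrm (dA x) = nrm (J0 G * x)" using x by (simp add: dA_def nrm_vcat nrm_hcat nrm_zero)
    also have "\<dots> \<le> nrm (J0 G) * nrm x" using x by (intro nrm_mult) auto
    finally show "nrm (dA x) \<le> (nrm (J0 G) + 1) * nrm x"
      using nrm_nonneg[of x] by (simp add: algebra_simps)
    show "nrm (?dB x) \<le> (nrm (J0 G) + 1) * nrm x" "nrm (?dC x) \<le> (nrm (J0 G) + 1) * nrm x"
      using nrm_nonneg[of x] nrm_nonneg[of "J0 G"] by (simp_all add: nrm_zero)
    have "ip (gramQ G R b * gramP G R b) (dA x) = ip H22 (J0 G * x)"
      unfolding dA_def using x P(1) Q(1)
      by (subst ip_blocks) (auto simp: H22_def ip_zero_right[of "blk _ n _ _", simplified] intro!: carrier_matI)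
    also have "\<dots> = ip ((J0 G)\<^sup>T * H22) x"
      using x H22 by (subst ip_mult_right) auto
    finally have e: "ip (gramQ G R b * gramP G R b) (dA x) = ip ((J0 G)\<^sup>T * H22) x" .
    have z: "ip (gramQ G R b * clB G b) (?dB x) = 0" "ip (clC G b * gramP G R b) (?dC x) = 0"
      using P(1) Q(1) by (simp_all add: ip_def)
    show "\<bar>ip (gramQ G R b * gramP G R b) (dA x) + ip (gramQ G R b * clB G b) (?dB x)
        + ip (clC G b * gramP G R b) (?dC x) - ip ((J0 G)\<^sup>T * H22) x\<bar> \<le> (nrm (J0 G) + 1) * (nrm x)\<^sup>2"
      unfolding e z using nrm_nonneg[of "J0 G"] by simp
    show "t \<cdot>\<^sub>m x \<in> ?S" for t using x xs by (auto simp: transpose_smult)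
    show "ip ((J0 G)\<^sup>T * H22) (t \<cdot>\<^sub>m x) = t * ip ((J0 G)\<^sup>T * H22) x" for t
      using x H22 by (intro ip_smult_right) auto
    fix P'
    assume P': "P' \<in> carrier_mat (2 * n) (2 * n)"
      "(clA G R b + dA x) * P' + P' * (clA G R b + dA x)\<^sup>T + (clB G b + ?dB x) * (clB G b + ?dB x)\<^sup>T
        = 0\<^sub>m (2 * n) (2 * n)"
      "\<exists>!P'. P' \<in> carrier_mat (2 * n) (2 * n) \<and>
        (clA G R b + dA x) * P' + P' * (clA G R b + dA x)\<^sup>T + (clB G b + ?dB x) * (clB G b + ?dB x)\<^sup>T
        = 0\<^sub>m (2 * n) (2 * n)"
    have id: "clA G R b + dA x = clA G (R + x) b" "clB G b + ?dB x = clB G b" "clC G b + ?dC x = clC G b"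
      using x b R c by (auto simp: dA_def clA_add_R)
    show "?F x = ip ((clC G b + ?dC x)\<^sup>T * (clC G b + ?dC x)) P' - ip ((clC G b)\<^sup>T * clC G b) (gramP G R b)"
      unfolding id costE_eq_gramP[OF b hw] using costE_eq[OF b P'[unfolded id]] by simp
  qed (use nrm_nonneg[of "J0 G"] in auto)
  also have "\<dots> \<longleftrightarrow> ((J0 G)\<^sup>T * H22)\<^sup>T = - ((J0 G)\<^sup>T * H22)"
    using H22 by (intro symmetric_annihilator) (auto intro!: carrier_matI)
  also have "\<dots> \<longleftrightarrow> H22\<^sup>T * J0 G = J0 G * H22"
    using H22 by (simp add: transpose_mult_dim J_transpose transpose_uminus)
  \<comment> \<open>Multiplying by \<open>J0 G\<close> on both sides exchanges the two equations,
    since J0 squared is -1.\<close>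
  also have "\<dots> \<longleftrightarrow> J0 G * H22\<^sup>T = H22 * J0 G"
  proof
    assume "H22\<^sup>T * J0 G = J0 G * H22"
    then have "J0 G * (H22\<^sup>T * J0 G) * J0 G = J0 G * (J0 G * H22) * J0 G" by simp
    then have "J0 G * H22\<^sup>T * (J0 G * J0 G) = (J0 G * J0 G) * H22 * J0 G"
      using H22 by (simp add: mult_assoc_dim)
    then show "J0 G * H22\<^sup>T = H22 * J0 G" unfolding J0_square using H22 by simp
  next
    assume "J0 G * H22\<^sup>T = H22 * J0 G"
    then have "J0 G * (J0 G * H22\<^sup>T) * J0 G = J0 G * (H22 * J0 G) * J0 G" by simp
    then have "(J0 G * J0 G) * H22\<^sup>T * J0 G = J0 G * H22 * (J0 G * J0 G)"
      using H22 by (simp add: mult_assoc_dim)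
    then show "H22\<^sup>T * J0 G = J0 G * H22" unfolding J0_square using H22 by simp
  qed
  also have "\<dots> \<longleftrightarrow> (H22 * J0 G)\<^sup>T = - (H22 * J0 G)"
    using H22 by (simp add: transpose_mult_dim J_transpose)
  finally show ?thesis .
qed

text \<open>Nothing about the derivative in R is assumed, hence the symmetrised Phi.\<close>

lemma dE_b_zero_iff:
  assumes b: "b \<in> carrier_mat n (m2 + p)" and R: "R \<in> carrier_mat n n" and hw: "hurwitz (clA G R b)"
  defines "H22 \<equiv> blk (gramQ G R b * gramP G R b) n 2 2"
  defines "\<Phi> \<equiv> (1/2) \<cdot>\<^sub>m (H22 * J0 G + J0 G * H22\<^sup>T)"
  shows "dE_b_zero G R b \<longleftrightarrow> gradb R b \<Phi> = 0\<^sub>m n (m2 + p)"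
proof -
  note P = gramP_solution[OF b hw] and Q = gramQ_solution[OF b hw] and c = closed_loop_carrier[OF b]
  let ?H = "gramQ G R b * gramP G R b"
  let ?S = "carrier_mat n (m2 + p)"
  let ?F = "\<lambda>x. costE G R (b + x) - costE G R b"
  define dA where "dA x = vcat (hcat (0\<^sub>m n n) (pB2 G * ctrl_c G x)) (hcat (x * bfC G) (aL b x + aQ x))" for x
  define dB where "dB x = vcat (0\<^sub>m n (m1 + m2)) (x * bfD G)" for x
  define dC where "dC x = hcat (0\<^sub>m p0 n) (pD0 G * ctrl_c G x)" for x
  define kc where "kc = nrm (J2 G * (bfI G)\<^sup>T) * nrm (J0 G)"
  define ka where "ka = nrm (bigJ G) * nrm (J0 G)"
  \<comment> \<open>The sum of all coefficients that occur, so that each estimate follows by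
    dropping nonnegative terms. The last summand covers the error from \<open>aQ\<close>; the 1
    ensures positivity.\<close>
  define k where "k = 1 + nrm (pB2 G) * kc + nrm (bfC G) + ka * nrm b + ka + nrm (bfD G) + nrm (pD0 G) * kc + nrm H22 * ka"
  have kc0: "kc \<ge> 0" and ka0: "ka \<ge> 0" by (simp_all add: kc_def ka_def nrm_nonneg)
  have "dE_b_zero G R b \<longleftrightarrow> (\<forall>\<epsilon>>0. \<exists>\<delta>>0. \<forall>x\<in>?S. frob x < \<delta> \<longrightarrow> \<bar>?F x\<bar> \<le> \<epsilon> * frob x)"
    by (simp add: dE_b_zero_def Ball_def imp_conjL)
  also have "\<dots> \<longleftrightarrow> (\<forall>x\<in>?S. ip (gradb R b \<Phi>) x = 0)"
  proof (rule lyapunov_cost_critical_iff[OF hw c P(1,2) Q, where r = n and c = "m2 + p" and dA = dA and dB = dB and dC = dC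
        and k = k])
    show "k > 0"
      unfolding k_def using kc0 ka0 by (intro add_pos_nonneg mult_nonneg_nonneg nrm_nonneg) auto
    fix x :: "real mat" assume x: "x \<in> ?S"
    show "dA x \<in> carrier_mat (2 * n) (2 * n)" "dB x \<in> carrier_mat (2 * n) (m1 + m2)" "dC x \<in> carrier_mat p0 (2 * n)"
      using x b by (auto simp: dA_def dB_def dC_def intro!: carrier_matI)
    have nc: "nrm (M * ctrl_c G x) \<le> nrm M * kc * nrm x" if "dim_col M = m2" for M
    proof -
      have "nrm (M * ctrl_c G x) \<le> nrm M * nrm (ctrl_c G x)" using that by (intro nrm_mult) simp
      also have "\<dots> \<le> nrm M * (kc * nrm x)"
        using nrm_ctrl_c[OF x] by (intro mult_left_mono nrm_nonneg) (simp add: kc_def)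
      finally show ?thesis by (simp add: mult.assoc)
    qed
    have aQb: "nrm (aQ x) \<le> ka * (nrm x)\<^sup>2" using nrm_aQ[OF x] by (simp add: ka_def)
    have pos: "0 \<le> nrm (pB2 G) * kc * nrm x" "0 \<le> nrm (bfC G) * nrm x" "0 \<le> ka * nrm b * nrm x" "0 \<le> ka * nrm x"
      "0 \<le> nrm (bfD G) * nrm x" "0 \<le> nrm (pD0 G) * kc * nrm x" "0 \<le> nrm H22 * ka * nrm x" "0 \<le> nrm x"
      using kc0 ka0 by (simp_all add: nrm_nonneg)
    have kx: "k * nrm x = nrm x + nrm (pB2 G) * kc * nrm x + nrm (bfC G) * nrm x + ka * nrm b * nrm x + ka * nrm x
        + nrm (bfD G) * nrm x + nrm (pD0 G) * kc * nrm x + nrm H22 * ka * nrm x"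
      by (simp add: k_def algebra_simps)
    show "nrm (dA x) \<le> k * nrm x" if "nrm x \<le> 1"
    proof -
      have "nrm (dA x) = nrm (pB2 G * ctrl_c G x) + nrm (x * bfC G) + nrm (aL b x + aQ x)"
        using x b by (simp add: dA_def nrm_vcat nrm_hcat nrm_zero)
      moreover have "nrm (aL b x + aQ x) \<le> nrm (aL b x) + nrm (aQ x)"
        using x b by (intro nrm_add) auto
      moreover have "nrm (aL b x) \<le> ka * nrm b * nrm x"
        using nrm_aL[OF b x] by (simp add: ka_def)
      moreover have "nrm (aQ x) \<le> ka * nrm x"
      proof -
        have "(nrm x)\<^sup>2 \<le> nrm x * 1"
          unfolding power2_eq_square using that by (intro mult_left_mono nrm_nonneg)
        then have "ka * (nrm x)\<^sup>2 \<le> ka * nrm x" using ka0 by (intro mult_left_mono) auto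
        with aQb show ?thesis by linarith
      qed
      moreover have "nrm (pB2 G * ctrl_c G x) \<le> nrm (pB2 G) * kc * nrm x" by (rule nc) simp
      moreover have "nrm (x * bfC G) \<le> nrm (bfC G) * nrm x"
        using x nrm_mult[of x "bfC G"] by (simp add: mult.commute)
      ultimately show ?thesis using pos unfolding kx by linarith
    qed
    show "nrm (dB x) \<le> k * nrm x"
    proof -
      have "nrm (dB x) \<le> nrm (bfD G) * nrm x"
        using x nrm_mult[of x "bfD G"] by (simp add: dB_def nrm_vcat nrm_zero mult.commute)
      then show ?thesis using pos unfolding kx by linarith
    qed
    show "nrm (dC x) \<le> k * nrm x"
    proof -
      have "nrm (dC x) \<le> nrm (pD0 G) * kc * nrm x"
        using nc[of "pD0 G"] by (simp add: dC_def nrm_hcat nrm_zero)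
      then show ?thesis using pos unfolding kx by linarith
    qed
    have H: "?H \<in> carrier_mat (2 * n) (2 * n)" using P(1) Q(1) by simp
    have "ip ?H (dA x) = ip (blk ?H n 1 2) (pB2 G * ctrl_c G x) + ip (blk ?H n 2 1) (x * bfC G)
        + (ip H22 (aL b x) + ip H22 (aQ x))"
      unfolding dA_def using x b H
      by (subst ip_blocks)
        (auto simp: H22_def ip_add_right ip_zero_right[of "blk _ n _ _", simplified] intro!: carrier_matI)
    moreover have "ip (gramQ G R b * clB G b) (dB x)
        = ip (blk (gramQ G R b) n 2 1 * Bcat G + blk (gramQ G R b) n 2 2 * (b * bfD G)) (x * bfD G)"
      unfolding clB_def dB_def using x b Q(1) by (intro ip_mult_vcat) (auto intro!: carrier_matI)
    moreover have "ip (clC G b * gramP G R b) (dC x)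
        = ip (pC0 G * blk (gramP G R b) n 1 2 + pD0 G * ctrl_c G b * blk (gramP G R b) n 2 2) (pD0 G * ctrl_c G x)"
      unfolding clC_def dC_def using x b P(1) by (intro ip_hcat_mult) (auto intro!: carrier_matI)
    \<comment> \<open>The quadratic part of a is the only departure from linearity in x, because c
      and hence B and C are affine in b.\<close>
    ultimately have e: "ip ?H (dA x) + ip (gramQ G R b * clB G b) (dB x) + ip (clC G b * gramP G R b) (dC x)
        - ip (gradb R b \<Phi>) x = ip H22 (aQ x)"
      unfolding \<Phi>_def H22_def ip_gradb[OF b x hw] by simp
    have "\<bar>ip H22 (aQ x)\<bar> \<le> nrm H22 * nrm (aQ x)"
      using x by (intro ip_le_nrm) (auto simp: H22_def)
    also have "\<dots> \<le> nrm H22 * (ka * (nrm x)\<^sup>2)"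
      using aQb by (intro mult_left_mono nrm_nonneg)
    also have "\<dots> \<le> k * (nrm x)\<^sup>2"
      unfolding mult.assoc[symmetric] using kc0 ka0
      by (intro mult_right_mono) (auto simp: k_def nrm_nonneg)
    finally show "\<bar>ip ?H (dA x) + ip (gramQ G R b * clB G b) (dB x) + ip (clC G b * gramP G R b) (dC x)
        - ip (gradb R b \<Phi>) x\<bar> \<le> k * (nrm x)\<^sup>2"
      unfolding e .
    show "t \<cdot>\<^sub>m x \<in> ?S" for t using x by simp
    show "ip (gradb R b \<Phi>) (t \<cdot>\<^sub>m x) = t * ip (gradb R b \<Phi>) x" for t
      using x by (intro ip_smult_right) auto
    fix P'
    assume P': "P' \<in> carrier_mat (2 * n) (2 * n)"
      "(clA G R b + dA x) * P' + P' * (clA G R b + dA x)\<^sup>T + (clB G b + dB x) * (clB G b + dB x)\<^sup>T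
        = 0\<^sub>m (2 * n) (2 * n)"
      "\<exists>!P'. P' \<in> carrier_mat (2 * n) (2 * n) \<and>
        (clA G R b + dA x) * P' + P' * (clA G R b + dA x)\<^sup>T + (clB G b + dB x) * (clB G b + dB x)\<^sup>T
        = 0\<^sub>m (2 * n) (2 * n)"
    have id: "clA G R b + dA x = clA G R (b + x)" "clB G b + dB x = clB G (b + x)" "clC G b + dC x = clC G (b + x)"
      using x b R by (auto simp: dA_def dB_def dC_def clA_add_b clB_add clC_add)
    have bx: "b + x \<in> carrier_mat n (m2 + p)" using b x by simp
    show "?F x = ip ((clC G b + dC x)\<^sup>T * (clC G b + dC x)) P' - ip ((clC G b)\<^sup>T * clC G b) (gramP G R b)"
      unfolding id costE_eq_gramP[OF b hw] using costE_eq[OF bx P'[unfolded id]] by simp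
  qed auto
  also have "\<dots> \<longleftrightarrow> gradb R b \<Phi> = 0\<^sub>m n (m2 + p)"
  proof
    assume "\<forall>x\<in>?S. ip (gradb R b \<Phi>) x = 0"
    \<comment> \<open>The directions fill the whole matrix space, so the gradient itself is an
      admissible test direction.\<close>
    then have "ip (gradb R b \<Phi>) (gradb R b \<Phi>) = 0" by (auto intro!: carrier_matI)
    then show "gradb R b \<Phi> = 0\<^sub>m n (m2 + p)" using ip_self_eq_0[of "gradb R b \<Phi>"] by simp
  qed (simp add: ip_def)
  finally show ?thesis .
qed

end

theorem theorem1:
  fixes G :: plant and n m1 m2 p p0 :: nat and R b :: "real mat"
  assumes "even n" "even m1" "even m2" "0 < n" "0 < m1" "0 < m2" "0 < p" "0 < p0"
    and "pA G \<in> carrier_mat n n" "pB1 G \<in> carrier_mat n m1" "pB2 G \<in> carrier_mat n m2"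
    and "pC G \<in> carrier_mat p n" "pD G \<in> carrier_mat p m1"
    and "pC0 G \<in> carrier_mat p0 n" "pD0 G \<in> carrier_mat p0 m2"
    and "R \<in> carrier_mat n n" "transpose_mat R = R"
    and "b \<in> carrier_mat n (m2 + p)"
    and "hurwitz (clA G R b)"
  shows "(dE_R_zero G R b \<and> dE_b_zero G R b) \<longleftrightarrow>
    (\<exists>\<Phi> \<in> carrier_mat n n. transpose_mat \<Phi> = - \<Phi> \<and>
       (let H = gramQ G R b * gramP G R b; P = gramP G R b; Q = gramQ G R b in
        blk H n 2 2 = - (\<Phi> * J0 G) \<and>
        opM G R b \<Phi> b + blk H n 2 1 * transpose_mat (bfC G)
          + blk Q n 2 1 * Bcat G * transpose_mat (bfD G)
          + J0 G * (transpose_mat (blk H n 1 2) * pB2 G + blk P n 2 1 * transpose_mat (pC0 G) * pD0 G)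
              * J2 G * transpose_mat (bfI G)
          = 0\<^sub>m n (m2 + p)))"
proof -
  interpret plant_dims G n m1 m2 p p0 using assms by unfold_locales
  define H22 where "H22 = blk (gramQ G R b * gramP G R b) n 2 2"
  have H22: "H22 \<in> carrier_mat n n" by (auto simp: H22_def intro!: carrier_matI)
  define \<Psi> where "\<Psi> = H22 * J0 G"
  have \<Psi>: "\<Psi> \<in> carrier_mat n n" using H22 by (auto simp: \<Psi>_def intro!: carrier_matI)
  \<comment> \<open>Since J0 squared is -1, the first equation determines Phi: the existential
    quantifier has a single candidate.\<close>
  have H22_eq: "H22 = - (\<Phi> * J0 G) \<longleftrightarrow> \<Phi> = \<Psi>" if \<Phi>: "\<Phi> \<in> carrier_mat n n" for \<Phi>
  proof
    assume "H22 = - (\<Phi> * J0 G)"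
    then have "\<Psi> = - (\<Phi> * (J0 G * J0 G))" using \<Phi> by (simp add: \<Psi>_def mult_assoc_dim)
    then show "\<Phi> = \<Psi>" using \<Phi> by (simp add: J0_square)
  next
    assume "\<Phi> = \<Psi>"
    then have "- (\<Phi> * J0 G) = - (H22 * (J0 G * J0 G))" using H22 by (simp add: \<Psi>_def mult_assoc_dim)
    then show "H22 = - (\<Phi> * J0 G)" using H22 by (simp add: J0_square)
  qed
  have sym: "(1/2) \<cdot>\<^sub>m (H22 * J0 G + J0 G * H22\<^sup>T) = \<Psi>" if "\<Psi>\<^sup>T = - \<Psi>"
  proof -
    have "J0 G * H22\<^sup>T = \<Psi>"
      using that H22 by (simp add: \<Psi>_def transpose_mult_dim J_transpose)
    then show ?thesis
      using \<Psi> unfolding \<Psi>_def[symmetric] by (intro eq_matI) auto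
  qed
  \<comment> \<open>The R-condition makes \<open>\<Psi>\<close> antisymmetric; under it
    \<open>sym\<close> replaces the symmetrised matrix of the b-condition by
    \<open>\<Psi>\<close>.\<close>
  have "(dE_R_zero G R b \<and> dE_b_zero G R b) \<longleftrightarrow> \<Psi>\<^sup>T = - \<Psi> \<and> gradb R b \<Psi> = 0\<^sub>m n (m2 + p)"
    using dE_R_zero_iff[of b R] dE_b_zero_iff[of b R] sym assms by (auto simp: \<Psi>_def H22_def)
  also have "\<dots> \<longleftrightarrow> (\<exists>\<Phi> \<in> carrier_mat n n. \<Phi>\<^sup>T = - \<Phi> \<and> H22 = - (\<Phi> * J0 G) \<and> gradb R b \<Phi> = 0\<^sub>m n (m2 + p))"
    using \<Psi> H22_eq by auto
  finally show ?thesis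
    unfolding gradb_def H22_def Let_def .
qed

end
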